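(* Let $n\ge 4$ and consider $M=G/H=SO(n)/(SO(2)\times SO(n-3))$ as a homogeneous $\Phi$-space of order $4$ generated by $\Phi(A)=BAB^{-1}$ with $B=\operatorname{diag}\left\{1,\begin{pmatrix}0&1\\-1&0\end{pmatrix},-1,\dots,-1\right\}$ ($n-3$ entries equal to $-1$). Let $f_0=\frac12(\theta-\theta^3)$ be the only (up to sign) canonical $f$-structure on this space. Then $f_0$ is 1) a Killing $f$-structure with respect to an invariant Riemannian metric if and only if the characteristic numbers of the metric are $(1,\frac43)$; 2) a nearly Kähler $f$-structure with respect to an invariant Riemannian metric if and only if the characteristic numbers of the metric are $(1,t)$, $t>0$; 3) a $G_1f$-structure with respect to any invariant Riemannian metric.
   Context: Here $G=SO(n)$ and $H=SO(2)\times SO(n-3)$ is embedded block-diagonally as $\operatorname{diag}\{1,A_1,A_2\}$, $A_1\in SO(2)$, $A_2\in SO(n-3)$; $\mathfrak g=\mathfrak{so}(n)$, $\mathfrak h$ is the Lie algebra of $H$. The canonical reductive complement is $\mathfrak m=(\varphi-\mathrm{id})\mathfrak g$, where $\varphi=d\Phi_e$ (so $\varphi(X)=BXB^{-1}$); $\mathfrak g=\mathfrak h\oplus\mathfrak m$, and $\mathfrak m$ is identified with the tangent space at $o=H$. Put $\theta=\varphi|_{\mathfrak m}$. Explicitly, $\mathfrak m=\mathfrak m_1\oplus\mathfrak m_2\oplus\mathfrak m_3$, where, within skew-symmetric matrices $S=(s_{ij})$, - $\mathfrak m_1$: only $s_{12},s_{13}$ (and $s_{21}=-s_{12}$, $s_{31}=-s_{13}$)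 may be nonzero; - $\mathfrak m_2$: only $s_{2j},s_{3j}$, $4\le j\le n$ (and their negatives $s_{j2},s_{j3}$) may be nonzero; - $\mathfrak m_3$: only $s_{1j}$, $4\le j\le n$ (and $s_{j1}=-s_{1j}$) may be nonzero. An invariant $(1,1)$-tensor field on $G/H$ is identified with its value at $o$, an $\mathrm{Ad}(H)$-invariant endomorphism of $\mathfrak m$; it is canonical if it is a polynomial in $\theta$. An $f$-structure is a $(1,1)$-tensor field $f$ with $f^3+f=0$. Explicitly, $f_0$ sends $S\in\mathfrak m$ to the skew-symmetric matrix in $\mathfrak m$ with $(1,2)$-entry $s_{13}$, $(1,3)$-entry $-s_{12}$, $(2,j)$-entry $-s_{3j}$, $(3,j)$-entry $s_{2j}$, and $(1,j)$-entry $0$ ($4\le j\le n$). Let $g_0=-K|_{\mathfrak m\times\mathfrak m}$, where $K$ is the Killing form of $\mathfrak{so}(n)$. Invariant Riemannian metrics are considered up to a positive coefficient, and are the metrics $$g=g_0|_{\mathfrak m_1}+s\,g_0|_{\mathfrak m_2}+t\,g_0|_{\mathfrak m_3},\qquad s,t>0$$ (with $\mathfrak m_1,\mathfrak m_2,\mathfrak m_3$ mutually orthogonal); $(s,t)$ are called the characteristic numbers of $g$. Let $\nabla$ be the Levi-Civita connection of $g$. A metric $f$-structure is an $f$-structure with $g(fX,Y)+g(X,fY)=0$ for all vector fields $X,Y$. A metric $f$-structure $f$ is - a Killing $f$-structure if $\nabla_X(f)X=0$ for all vector fields $X$; - a nearly Kähler $f$-structure ($NKf$-structure) if $\nabla_{fX}(f)fX=0$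 for all vector fields $X$; - a $G_1f$-structure if $T(X,X)=0$ for all vector fields $X$, where $T(X,Y)=\frac14 f\big(\nabla_{fX}(f)fY-\nabla_{f^2X}(f)f^2Y\big)$. *)

theory Defs
  imports "HOL-Analysis.Analysis"
begin

section \<open>Matrices and the groups SO(n), H\<close>

type_synonym 'n sqmat = "real^'n^'n"

text \<open>
  A fixed enumeration of the index type by \<open>1, ..., n\<close>, so that the \<open>(i,j)\<close>-entry of \<open>A\<close>
  is \<open>A $ coord i $ coord j\<close>.
\<close>

definition coord :: "nat \<Rightarrow> 'n::finite" where
  "coord = (SOME e. bij_betw e {1..CARD('n)} (UNIV :: 'n set))"

definition tail_coords :: "'n::finite set" where
  "tail_coords = coord ` {4..CARD('n)}"

definition SO :: "('n::finite) sqmat set" where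
  "SO = {A. rotation_matrix A}"

definition so :: "('n::finite) sqmat set" where
  "so = {X. transpose X = - X}"

text \<open>
  The matrices \<open>diag{1, A1, A2}\<close> with \<open>A1\<close> in \<open>SO(2)\<close> and \<open>A2\<close> in \<open>SO(n-3)\<close>. For a block-diagonal
  \<open>A\<close> in \<open>SO(n)\<close> with first entry 1, the blocks are orthogonal and \<open>det A1 * det A2 = 1\<close>, so it
  suffices to prescribe \<open>det A1 = 1\<close>.
\<close>

definition H :: "('n::finite) sqmat set" where
  "H = {A \<in> SO.
     (\<forall>i j. A $ i $ j \<noteq> 0 \<longrightarrow>
        (i = coord 1 \<and> j = coord 1) \<or>
        (i \<in> {coord 2, coord 3} \<and> j \<in> {coord 2, coord 3}) \<or>
        (i \<in> tail_coords \<and> j \<in> tail_coords)) \<and>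
     A $ coord 1 $ coord 1 = 1 \<and>
     A $ coord 2 $ coord 2 * A $ coord 3 $ coord 3
       - A $ coord 2 $ coord 3 * A $ coord 3 $ coord 2 = 1}"

definition Ad :: "('n::finite) sqmat \<Rightarrow> 'n sqmat \<Rightarrow> 'n sqmat" where
  "Ad a X = a ** X ** matrix_inv a"

definition commutator :: "('n::finite) sqmat \<Rightarrow> 'n sqmat \<Rightarrow> 'n sqmat" where
  "commutator X Y = X ** Y - Y ** X"

definition mexp :: "('n::finite) sqmat \<Rightarrow> 'n sqmat" where
  "mexp X = (\<Sum>k. (1 / fact k) *\<^sub>R ((\<lambda>Y. X ** Y) ^^ k) (mat 1))"


section \<open>The automorphism and the reductive complement\<close>

definition B :: "('n::finite) sqmat" where
  "B = (\<chi> i j.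
     if i = coord 1 \<and> j = coord 1 then 1
     else if i = coord 2 \<and> j = coord 3 then 1
     else if i = coord 3 \<and> j = coord 2 then - 1
     else if i \<in> tail_coords \<and> i = j then - 1
     else 0)"

definition Phi :: "('n::finite) sqmat \<Rightarrow> 'n sqmat" where
  "Phi A = B ** A ** matrix_inv B"

text \<open>
  \<open>Phi\<close> is the restriction to \<open>SO\<close> of a linear map of the matrix space, so the differential of
  \<open>Phi\<close> at the identity is the restriction to \<open>so\<close> of the derivative in the matrix space.
\<close>

definition phi :: "('n::finite) sqmat \<Rightarrow> 'n sqmat" where
  "phi = frechet_derivative Phi (at (mat 1))"

definition \<mm> :: "('n::finite) sqmat set" where
  "\<mm> = (\<lambda>X. phi X - X) ` so"

definition skew_supported :: "('n::finite \<Rightarrow> 'n \<Rightarrow> bool) \<Rightarrow> 'n sqmat set" where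
  "skew_supported P = {S \<in> so. \<forall>i j. S $ i $ j \<noteq> 0 \<longrightarrow> P i j \<or> P j i}"

definition \<mm>1 :: "('n::finite) sqmat set" where
  "\<mm>1 = skew_supported (\<lambda>i j. i = coord 1 \<and> j \<in> {coord 2, coord 3})"

definition \<mm>2 :: "('n::finite) sqmat set" where
  "\<mm>2 = skew_supported (\<lambda>i j. i \<in> {coord 2, coord 3} \<and> j \<in> tail_coords)"

definition \<mm>3 :: "('n::finite) sqmat set" where
  "\<mm>3 = skew_supported (\<lambda>i j. i = coord 1 \<and> j \<in> tail_coords)"


section \<open>Invariant metrics\<close>

definition is_orthonormal_basis :: "'a::euclidean_space set \<Rightarrow> 'a set \<Rightarrow> bool" where
  "is_orthonormal_basis V b \<longleftrightarrow>
     pairwise orthogonal b \<and> (\<forall>x\<in>b. norm x = 1) \<and> span b = V"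

text \<open>The trace of an endomorphism \<open>L\<close> of a subspace \<open>V\<close>.\<close>

definition trace_on :: "'a::euclidean_space set \<Rightarrow> ('a \<Rightarrow> 'a) \<Rightarrow> real" where
  "trace_on V L = (\<Sum>x\<in>(SOME b. is_orthonormal_basis V b). L x \<bullet> x)"

definition killing_form :: "('n::finite) sqmat \<Rightarrow> 'n sqmat \<Rightarrow> real" where
  "killing_form X Y = trace_on so (\<lambda>Z. commutator X (commutator Y Z))"

definition g0 :: "('n::finite) sqmat \<Rightarrow> 'n sqmat \<Rightarrow> real" where
  "g0 X Y = - killing_form X Y"

text \<open>
  \<open>g\<close> (restricted to \<open>\<mm>\<close>) is, up to a positive coefficient \<open>c\<close>, the invariant Riemannian metric
  with characteristic numbers \<open>(s, t)\<close>.
\<close>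

definition characteristic_numbers ::
    "(('n::finite) sqmat \<Rightarrow> 'n sqmat \<Rightarrow> real) \<Rightarrow> real \<times> real \<Rightarrow> bool" where
  "characteristic_numbers g st \<longleftrightarrow> (case st of (s, t) \<Rightarrow>
     s > 0 \<and> t > 0 \<and>
     (\<exists>c>0. \<forall>X1\<in>\<mm>1. \<forall>X2\<in>\<mm>2. \<forall>X3\<in>\<mm>3. \<forall>Y1\<in>\<mm>1. \<forall>Y2\<in>\<mm>2. \<forall>Y3\<in>\<mm>3.
        g (X1 + X2 + X3) (Y1 + Y2 + Y3) = c * (g0 X1 Y1 + s * g0 X2 Y2 + t * g0 X3 Y3)))"


section \<open>Functions and vector fields on G/H\<close>

text \<open>\<open>Ck_on k U f\<close>: the function \<open>f\<close> is of class \<open>C^k\<close> on the open set \<open>U\<close>.\<close>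

primrec Ck_on ::
    "nat \<Rightarrow> 'a::real_normed_vector set \<Rightarrow> ('a \<Rightarrow> 'b::real_normed_vector) \<Rightarrow> bool" where
  "Ck_on 0 U f \<longleftrightarrow> continuous_on U f"
| "Ck_on (Suc k) U f \<longleftrightarrow>
     (\<forall>x\<in>U. f differentiable (at x)) \<and>
     (\<forall>v. Ck_on k U (\<lambda>x. frechet_derivative f (at x) v))"

text \<open>Smoothness on the embedded submanifold \<open>SO\<close> of the matrix space.\<close>

definition smooth_on_SO :: "(('n::finite) sqmat \<Rightarrow> 'b::real_normed_vector) \<Rightarrow> bool" where
  "smooth_on_SO F \<longleftrightarrow>
     (\<exists>U E. open U \<and> SO \<subseteq> U \<and> (\<forall>k. Ck_on k U E) \<and> (\<forall>a\<in>SO. F a = E a))"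

text \<open>
  Objects on \<open>G/H\<close> are represented by their lifts to \<open>G = SO\<close>; values outside \<open>SO\<close> are irrelevant.
  A smooth function on \<open>G/H\<close> is a right \<open>H\<close>-invariant smooth function on \<open>G\<close>.

  The map \<open>(a, v) \<mapsto> d/dt (a exp(tv) H)\<close> at \<open>t = 0\<close> identifies the tangent bundle of \<open>G/H\<close> with
  the associated bundle of \<open>G \<times> \<mm>\<close> under \<open>(a h, v) ~ (a, Ad h v)\<close>. So a vector field on \<open>G/H\<close> is
  a smooth map \<open>X\<close> from \<open>G\<close> to \<open>\<mm>\<close> with \<open>X (a h) = Ad (inverse of h) (X a)\<close>, and
  an invariant tensor field acts on vector fields by applying its value at \<open>o\<close> pointwise.
\<close>

definition smooth_function :: "(('n::finite) sqmat \<Rightarrow> real) \<Rightarrow> bool" where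
  "smooth_function u \<longleftrightarrow> smooth_on_SO u \<and> (\<forall>a\<in>SO. \<forall>h\<in>H. u (a ** h) = u a)"

definition vector_field :: "(('n::finite) sqmat \<Rightarrow> 'n sqmat) \<Rightarrow> bool" where
  "vector_field X \<longleftrightarrow> smooth_on_SO X \<and> (\<forall>a\<in>SO. X a \<in> \<mm>) \<and>
     (\<forall>a\<in>SO. \<forall>h\<in>H. X (a ** h) = Ad (matrix_inv h) (X a))"

definition derivation ::
    "(('n::finite) sqmat \<Rightarrow> 'n sqmat) \<Rightarrow> ('n sqmat \<Rightarrow> real) \<Rightarrow> 'n sqmat \<Rightarrow> real" where
  "derivation X u a = deriv (\<lambda>t. u (a ** mexp (t *\<^sub>R X a))) 0"

definition is_lie_bracket ::
    "(('n::finite) sqmat \<Rightarrow> 'n sqmat) \<Rightarrow> ('n sqmat \<Rightarrow> 'n sqmat) \<Rightarrow> ('n sqmat \<Rightarrow> 'n sqmat) \<Rightarrow> bool" where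
  "is_lie_bracket X Y Z \<longleftrightarrow> (\<forall>u. smooth_function u \<longrightarrow> (\<forall>a\<in>SO.
     derivation Z u a = derivation X (derivation Y u) a - derivation Y (derivation X u) a))"


section \<open>The Levi-Civita connection\<close>

definition affine_connection ::
    "((('n::finite) sqmat \<Rightarrow> 'n sqmat) \<Rightarrow> ('n sqmat \<Rightarrow> 'n sqmat) \<Rightarrow> ('n sqmat \<Rightarrow> 'n sqmat)) \<Rightarrow> bool" where
  "affine_connection D \<longleftrightarrow>
     (\<forall>X Y. vector_field X \<longrightarrow> vector_field Y \<longrightarrow> vector_field (D X Y)) \<and>
     (\<forall>X Y Z. vector_field X \<longrightarrow> vector_field Y \<longrightarrow> vector_field Z \<longrightarrow> (\<forall>a\<in>SO.
        D (\<lambda>b. X b + Y b) Z a = D X Z a + D Y Z a \<and>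
        D X (\<lambda>b. Y b + Z b) a = D X Y a + D X Z a)) \<and>
     (\<forall>u X Y. smooth_function u \<longrightarrow> vector_field X \<longrightarrow> vector_field Y \<longrightarrow> (\<forall>a\<in>SO.
        D (\<lambda>b. u b *\<^sub>R X b) Y a = u a *\<^sub>R D X Y a \<and>
        D X (\<lambda>b. u b *\<^sub>R Y b) a = derivation X u a *\<^sub>R Y a + u a *\<^sub>R D X Y a))"

definition levi_civita ::
    "(('n::finite) sqmat \<Rightarrow> 'n sqmat \<Rightarrow> real) \<Rightarrow>
     (('n sqmat \<Rightarrow> 'n sqmat) \<Rightarrow> ('n sqmat \<Rightarrow> 'n sqmat) \<Rightarrow> ('n sqmat \<Rightarrow> 'n sqmat)) \<Rightarrow> bool" where
  "levi_civita g D \<longleftrightarrow> affine_connection D \<and>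
     (\<forall>X Y. vector_field X \<longrightarrow> vector_field Y \<longrightarrow>
        is_lie_bracket X Y (\<lambda>a. D X Y a - D Y X a)) \<and>
     (\<forall>X Y Z. vector_field X \<longrightarrow> vector_field Y \<longrightarrow> vector_field Z \<longrightarrow> (\<forall>a\<in>SO.
        derivation X (\<lambda>b. g (Y b) (Z b)) a = g (D X Y a) (Z a) + g (Y a) (D X Z a)))"


section \<open>Canonical f-structures\<close>

definition invariant_endomorphism :: "(('n::finite) sqmat \<Rightarrow> 'n sqmat) \<Rightarrow> bool" where
  "invariant_endomorphism f \<longleftrightarrow>
     (\<forall>X\<in>\<mm>. f X \<in> \<mm>) \<and>
     (\<forall>X\<in>\<mm>. \<forall>Y\<in>\<mm>. f (X + Y) = f X + f Y) \<and>
     (\<forall>c. \<forall>X\<in>\<mm>. f (c *\<^sub>R X) = c *\<^sub>R f X) \<and>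
     (\<forall>h\<in>H. \<forall>X\<in>\<mm>. f (Ad h X) = Ad h (f X))"

definition f_structure :: "(('n::finite) sqmat \<Rightarrow> 'n sqmat) \<Rightarrow> bool" where
  "f_structure f \<longleftrightarrow> invariant_endomorphism f \<and> (\<forall>X\<in>\<mm>. f (f (f X)) + f X = 0)"

definition canonical :: "(('n::finite) sqmat \<Rightarrow> 'n sqmat) \<Rightarrow> bool" where
  "canonical f \<longleftrightarrow>
     (\<exists>N (c :: nat \<Rightarrow> real). \<forall>X\<in>\<mm>. f X = (\<Sum>k\<le>N. c k *\<^sub>R (phi ^^ k) X))"

definition f0 :: "('n::finite) sqmat \<Rightarrow> 'n sqmat" where
  "f0 X = (1 / 2) *\<^sub>R (phi X - (phi ^^ 3) X)"

text \<open>
  \<open>f\<close> is the only canonical f-structure up to sign; the zero endomorphism, which satisfies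
  \<open>f^3 + f = 0\<close> on every such space, is disregarded.
\<close>

definition only_canonical_f_structure :: "(('n::finite) sqmat \<Rightarrow> 'n sqmat) \<Rightarrow> bool" where
  "only_canonical_f_structure f \<longleftrightarrow>
     canonical f \<and> f_structure f \<and> (\<exists>X\<in>\<mm>. f X \<noteq> 0) \<and>
     (\<forall>f'. canonical f' \<and> f_structure f' \<and> (\<exists>X\<in>\<mm>. f' X \<noteq> 0) \<longrightarrow>
        (\<forall>X\<in>\<mm>. f' X = f X) \<or> (\<forall>X\<in>\<mm>. f' X = - f X))"

definition metric_f_structure ::
    "(('n::finite) sqmat \<Rightarrow> 'n sqmat \<Rightarrow> real) \<Rightarrow> ('n sqmat \<Rightarrow> 'n sqmat) \<Rightarrow> bool" where
  "metric_f_structure g f \<longleftrightarrow> f_structure f \<and>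
     (\<forall>X Y. vector_field X \<longrightarrow> vector_field Y \<longrightarrow>
        (\<forall>a\<in>SO. g (f (X a)) (Y a) + g (X a) (f (Y a)) = 0))"

text \<open>The field \<open>\<nabla>\<^sub>X(f)Y = \<nabla>\<^sub>X(f Y) - f (\<nabla>\<^sub>X Y)\<close>, where \<open>D\<close> is the connection.\<close>

definition cov_deriv_f ::
    "((('n::finite) sqmat \<Rightarrow> 'n sqmat) \<Rightarrow> ('n sqmat \<Rightarrow> 'n sqmat) \<Rightarrow> ('n sqmat \<Rightarrow> 'n sqmat)) \<Rightarrow>
     ('n sqmat \<Rightarrow> 'n sqmat) \<Rightarrow>
     ('n sqmat \<Rightarrow> 'n sqmat) \<Rightarrow> ('n sqmat \<Rightarrow> 'n sqmat) \<Rightarrow> ('n sqmat \<Rightarrow> 'n sqmat)" where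
  "cov_deriv_f D f X Y = (\<lambda>a. D X (f \<circ> Y) a - f (D X Y a))"

definition T_tensor ::
    "((('n::finite) sqmat \<Rightarrow> 'n sqmat) \<Rightarrow> ('n sqmat \<Rightarrow> 'n sqmat) \<Rightarrow> ('n sqmat \<Rightarrow> 'n sqmat)) \<Rightarrow>
     ('n sqmat \<Rightarrow> 'n sqmat) \<Rightarrow>
     ('n sqmat \<Rightarrow> 'n sqmat) \<Rightarrow> ('n sqmat \<Rightarrow> 'n sqmat) \<Rightarrow> ('n sqmat \<Rightarrow> 'n sqmat)" where
  "T_tensor D f X Y = (\<lambda>a. (1 / 4) *\<^sub>R f
     (cov_deriv_f D f (f \<circ> X) (f \<circ> Y) a - cov_deriv_f D f (f \<circ> f \<circ> X) (f \<circ> f \<circ> Y) a))"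

text \<open>In the following three notions \<open>D\<close> is meant to be the Levi-Civita connection of \<open>g\<close>.\<close>

definition killing_f_structure where
  "killing_f_structure g D f \<longleftrightarrow> metric_f_structure g f \<and>
     (\<forall>X. vector_field X \<longrightarrow> (\<forall>a\<in>SO. cov_deriv_f D f X X a = 0))"

definition NK_f_structure where
  "NK_f_structure g D f \<longleftrightarrow> metric_f_structure g f \<and>
     (\<forall>X. vector_field X \<longrightarrow> (\<forall>a\<in>SO. cov_deriv_f D f (f \<circ> X) (f \<circ> X) a = 0))"

definition G1_f_structure where
  "G1_f_structure g D f \<longleftrightarrow> metric_f_structure g f \<and>
     (\<forall>X. vector_field X \<longrightarrow> (\<forall>a\<in>SO. T_tensor D f X X a = 0))"


section \<open>Homogeneous \<open>\<Phi>\<close>-spaces\<close>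

text \<open>
  \<open>SO/K\<close> is a homogeneous \<open>\<Phi>\<close>-space of order \<open>k\<close>: \<open>F\<close> is an automorphism of the Lie group \<open>SO\<close> of
  order exactly \<open>k\<close>, and the subgroup \<open>K\<close> lies between the fixed point group of \<open>F\<close> and
  the identity component of the fixed point group.
\<close>

definition homogeneous_Phi_space ::
    "('n::finite) sqmat set \<Rightarrow> ('n sqmat \<Rightarrow> 'n sqmat) \<Rightarrow> nat \<Rightarrow> bool" where
  "homogeneous_Phi_space K F k \<longleftrightarrow>
     smooth_on_SO F \<and> bij_betw F SO SO \<and>
     (\<forall>a\<in>SO. \<forall>b\<in>SO. F (a ** b) = F a ** F b) \<and>
     (\<forall>a\<in>SO. (F ^^ k) a = a) \<and> (\<forall>j. 0 < j \<and> j < k \<longrightarrow> (\<exists>a\<in>SO. (F ^^ j) a \<noteq> a)) \<and>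
     mat 1 \<in> K \<and> (\<forall>a\<in>K. \<forall>b\<in>K. a ** b \<in> K) \<and> (\<forall>a\<in>K. matrix_inv a \<in> K) \<and>
     connected_component_set {a \<in> SO. F a = a} (mat 1) \<subseteq> K \<and> K \<subseteq> {a \<in> SO. F a = a}"

end

theory Submission
  imports Defs
begin

text \<open>
  The automorphism is conjugation by \<open>B\<close>, so \<open>H\<close> is cut out of the centralizer of \<open>B\<close> by the
  condition that the first entry is 1. Splitting the indices into blocks of sizes \<open>1, 2, n - 3\<close>
  gives \<open>[\<mm>\<^sub>i, \<mm>\<^sub>j] \<subseteq> \<mm>\<^sub>k\<close> for distinct \<open>i, j, k\<close> and \<open>[\<mm>\<^sub>i, \<mm>\<^sub>i] \<subseteq> \<hh>\<close>. On \<open>so(n)\<close> the form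
  \<open>- K\<close> is \<open>n - 2\<close> times the Frobenius inner product, so the metric is explicit.

  With respect to the identification of vector fields with equivariant maps \<open>G \<rightarrow> \<mm>\<close>, the
  Levi-Civita connection is \<open>(\<nabla>\<^sub>X Y)(a) = d/d\<tau> Y(a exp(\<tau> X(a))) + \<Lambda>(X(a), Y(a))\<close> with \<open>\<Lambda>\<close> algebraic.
  To read off the torsion it is enough to differentiate the functions \<open>a \<mapsto> Q \<bullet> a B a\<^sup>T\<close>, the
  coordinates of the immersion \<open>a H \<mapsto> a B a\<^sup>-\<^sup>1\<close>, because \<open>[v, B] = 0\<close> forces the
  \<open>\<mm>\<close>-component of \<open>v\<close> to vanish. Hence \<open>\<nabla>\<^sub>x(f\<^sub>0)x\<close> is tensorial, and for \<open>x = x\<^sub>1 + x\<^sub>2 + x\<^sub>3\<close> it equals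
  \<open>(s - 1)/t [x\<^sub>1, \<theta> x\<^sub>2] + (3 (t - s) - 1)/2 [\<theta> x\<^sub>2, x\<^sub>3] + (3 (t - 1)/s - 1)/2 [\<theta> x\<^sub>1, x\<^sub>3]\<close>.
  Since \<open>f\<^sub>0 x\<close> has no \<open>\<mm>\<^sub>3\<close>-component and \<open>f\<^sub>0\<close> vanishes on \<open>\<mm>\<^sub>3\<close>, all three claims can be
  read off from this formula.
\<close>

section \<open>Matrix algebra\<close>

lemma matrix_add_rdistrib: "(A + C) ** (D :: real^'p^'n) = A ** D + C ** (D :: real^'p^'n)"
  for A C :: "real^'n^'m"
  by (vector matrix_matrix_mult_def sum.distrib[symmetric] field_simps)

lemma bilinear_matrix_mult: "bilinear ((**) :: real^'n^'m \<Rightarrow> real^'p^'n \<Rightarrow> _)"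
  unfolding bilinear_def
  by (auto intro!: linearI simp: matrix_add_ldistrib matrix_add_rdistrib scalar_matrix_assoc matrix_scalar_ac)

lemma bounded_bilinear_matrix_mult:
  "bounded_bilinear ((**) :: real^'n^'m \<Rightarrow> real^'p^'n \<Rightarrow> _)"
  using bilinear_conv_bounded_bilinear bilinear_matrix_mult by blast

text \<open>Matrix multiplication as a bounded bilinear map supplies the linearity rules collected
  in \<open>mm_simps\<close> and the product rule for curves of matrices.\<close>

interpretation mm: bounded_bilinear "(**) :: real^'n^'n \<Rightarrow> real^'n^'n \<Rightarrow> real^'n^'n"
  by (rule bounded_bilinear_matrix_mult)

lemmas mm_simps = mm.add_left mm.add_right mm.diff_left mm.diff_right mm.minus_left mm.minus_right
  mm.scaleR_left mm.scaleR_right mm.zero_left mm.zero_right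

lemma linear_transpose: "linear (transpose :: real^'n^'m \<Rightarrow> _)"
  by (rule linearI) (vector transpose_def)+

lemmas transpose_linear_simps = linear_add[OF linear_transpose] linear_diff[OF linear_transpose]
  linear_neg[OF linear_transpose] linear_cmul[OF linear_transpose] linear_0[OF linear_transpose]

section \<open>The Frobenius inner product and the commutator\<close>

lemma inner_matrix: "A \<bullet> C = (\<Sum>i\<in>UNIV. \<Sum>j\<in>UNIV. A$i$j * C$i$j)" for A C :: "real^'n^'m"
  by (simp add: inner_vec_def)

lemma inner_transpose: "transpose A \<bullet> transpose C = A \<bullet> C" for A C :: "real^'n^'m"
  unfolding inner_matrix transpose_def by (simp, rule sum.swap)

text \<open>The inner product is the Frobenius product tr (X^T Y), so multiplication by
  \<open>transpose A\<close> is the adjoint of multiplication by \<open>A\<close>. The proof only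
  reorders a triple sum.\<close>

lemma inner_mult_left: "(A ** X) \<bullet> Y = X \<bullet> (transpose A ** Y)" for A X Y :: "real^'n^'n"
proof -
  have "(A ** X) \<bullet> Y = (\<Sum>i\<in>UNIV. \<Sum>j\<in>UNIV. \<Sum>k\<in>UNIV. A$i$k * X$k$j * Y$i$j)"
    by (simp add: inner_matrix matrix_matrix_mult_def sum_distrib_right)
  also have "\<dots> = (\<Sum>i\<in>UNIV. \<Sum>k\<in>UNIV. \<Sum>j\<in>UNIV. A$i$k * X$k$j * Y$i$j)"
    by (rule sum.cong[OF refl], rule sum.swap)
  also have "\<dots> = (\<Sum>k\<in>UNIV. \<Sum>i\<in>UNIV. \<Sum>j\<in>UNIV. A$i$k * X$k$j * Y$i$j)"
    by (rule sum.swap)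
  also have "\<dots> = (\<Sum>k\<in>UNIV. \<Sum>j\<in>UNIV. \<Sum>i\<in>UNIV. A$i$k * X$k$j * Y$i$j)"
    by (rule sum.cong[OF refl], rule sum.swap)
  also have "\<dots> = X \<bullet> (transpose A ** Y)"
    by (simp add: inner_matrix matrix_matrix_mult_def sum_distrib_left transpose_def mult_ac)
  finally show ?thesis .
qed

lemma inner_mult_right: "(X ** A) \<bullet> Y = X \<bullet> (Y ** transpose A)" for A X Y :: "real^'n^'n"
proof -
  have "(X ** A) \<bullet> Y = (transpose A ** transpose X) \<bullet> transpose Y"
    by (metis inner_transpose matrix_transpose_mul)
  also have "\<dots> = transpose X \<bullet> (A ** transpose Y)"
    by (simp add: inner_mult_left)
  also have "\<dots> = X \<bullet> (Y ** transpose A)"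
    by (metis inner_transpose matrix_transpose_mul transpose_transpose)
  finally show ?thesis .
qed

lemma commutator_add_left: "commutator (X + Y) Z = commutator X Z + commutator Y Z"
  and commutator_add_right: "commutator Z (X + Y) = commutator Z X + commutator Z Y"
  and commutator_diff_left: "commutator (X - Y) Z = commutator X Z - commutator Y Z"
  and commutator_diff_right: "commutator Z (X - Y) = commutator Z X - commutator Z Y"
  and commutator_scaleR_left: "commutator (c *\<^sub>R X) Z = c *\<^sub>R commutator X Z"
  and commutator_scaleR_right: "commutator Z (c *\<^sub>R X) = c *\<^sub>R commutator Z X"
  and commutator_minus_left: "commutator (- X) Z = - commutator X Z"
  and commutator_minus_right: "commutator Z (- X) = - commutator Z X"
  and commutator_zero_left: "commutator 0 Z = 0"
  and commutator_zero_right: "commutator Z 0 = 0"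
  by (simp_all add: commutator_def mm_simps algebra_simps)

lemmas commutator_linear_simps = commutator_add_left commutator_add_right commutator_diff_left
  commutator_diff_right commutator_scaleR_left commutator_scaleR_right commutator_minus_left
  commutator_minus_right commutator_zero_left commutator_zero_right

lemma commutator_swap: "commutator X Y = - commutator Y X"
  by (simp add: commutator_def)

text \<open>The Jacobi identity. It converts the difference of two second derivatives of a test
  function into a single bracket.\<close>

lemma commutator_jacobi:
  "commutator X (commutator Y P) - commutator Y (commutator X P) = commutator (commutator X Y) P"
  by (simp add: commutator_def mm_simps matrix_mul_assoc)

section \<open>The Lie algebra so(n) and the group SO(n)\<close>

lemma so_iff: "X \<in> so \<longleftrightarrow> transpose X = - X"
  by (simp add: so_def)

lemma subspace_so: "subspace so"
  by (auto simp: subspace_def so_iff transpose_linear_simps)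

lemma commutator_in_so: "X \<in> so \<Longrightarrow> Y \<in> so \<Longrightarrow> commutator X Y \<in> so"
  by (simp add: so_iff commutator_def transpose_linear_simps matrix_transpose_mul mm_simps)

text \<open>The adjoints of left and right multiplication by \<open>X\<close> are the
  multiplications by \<open>transpose X = - X\<close>. This is the ad-invariance of the inner
  product, on which the metricity of the connection rests.\<close>

lemma commutator_skew_adjoint:
  assumes "X \<in> so" shows "commutator X Y \<bullet> Z = - (Y \<bullet> commutator X Z)"
proof -
  have "(X ** Y) \<bullet> Z = - (Y \<bullet> (X ** Z))" "(Y ** X) \<bullet> Z = - (Y \<bullet> (Z ** X))"
    using assms inner_mult_left[of X Y Z] inner_mult_right[of Y X Z] by (simp_all add: so_iff mm_simps)
  then show ?thesis by (simp add: commutator_def inner_diff_left inner_diff_right)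
qed

lemma SO_iff: "A \<in> SO \<longleftrightarrow> transpose A ** A = mat 1 \<and> det A = 1"
  by (simp add: SO_def rotation_matrix_def orthogonal_matrix)

lemma SO_orth: "A \<in> SO \<Longrightarrow> transpose A ** A = mat 1" "A \<in> SO \<Longrightarrow> A ** transpose A = mat 1"
  by (auto simp: SO_iff matrix_left_right_inverse)

text \<open>\<open>matrix_inv\<close> is a choice among two-sided inverses; the transpose shows that
  there is one, and cancellation shows that the chosen one is equal to it.\<close>

lemma matrix_inv_orthogonal:
  fixes A :: "real^'n^'n"
  assumes "transpose A ** A = mat 1" shows "matrix_inv A = transpose A"
proof -
  have 1: "A ** transpose A = mat 1" using assms by (simp add: matrix_left_right_inverse)
  have "A ** matrix_inv A = mat 1 \<and> matrix_inv A ** A = mat 1"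
    unfolding matrix_inv_def by (rule someI[of _ "transpose A"]) (simp add: assms 1)
  then show ?thesis by (metis assms matrix_mul_assoc matrix_mul_lid matrix_mul_rid)
qed

lemma SO_mult: "a \<in> SO \<Longrightarrow> b \<in> SO \<Longrightarrow> a ** b \<in> SO"
  unfolding SO_def rotation_matrix_def by (auto simp: orthogonal_matrix_mul det_mul)

lemma SO_transpose: "a \<in> SO \<Longrightarrow> transpose a \<in> SO"
  unfolding SO_def rotation_matrix_def by (auto simp: det_transpose)

lemma SO_one: "mat 1 \<in> SO"
  by (simp add: SO_iff)

lemma inner_conj_orthogonal:
  fixes a X Y :: "real^'n^'n"
  assumes "transpose a ** a = mat 1"
  shows "(a ** X ** transpose a) \<bullet> (a ** Y ** transpose a) = X \<bullet> Y"
proof -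
  have "(a ** X ** transpose a) \<bullet> (a ** Y ** transpose a)
      = (a ** X) \<bullet> (a ** Y ** (transpose a ** a))"
    by (simp add: inner_mult_right[of "a ** X"] matrix_mul_assoc)
  also have "\<dots> = X \<bullet> (transpose a ** a ** Y)"
    using assms by (simp add: inner_mult_left[of a X] matrix_mul_assoc)
  finally show ?thesis using assms by simp
qed

section \<open>The exponential\<close>

definition mpow :: "real^'n^'n \<Rightarrow> nat \<Rightarrow> real^'n^'n" where
  "mpow X k = ((\<lambda>Y. X ** Y) ^^ k) (mat 1)"

lemma mpow_Suc: "mpow X (Suc k) = X ** mpow X k"
  by (simp add: mpow_def)

lemma mpow_scaleR: "mpow (t *\<^sub>R X) k = t ^ k *\<^sub>R mpow X k"
proof (induction k)
  case (Suc k)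
  then show ?case by (simp add: mpow_Suc mm.scaleR_left mm.scaleR_right)
qed (simp add: mpow_def)

text \<open>With K a bound for the bilinear product, C = \<open>norm X * K\<close> works by
  induction. Geometric growth is harmless against the factorials of the exponential series.\<close>

lemma mpow_bound: "\<exists>C\<ge>0. \<forall>k. norm (mpow X k) \<le> C ^ k * norm (mat 1 :: real^'n^'n)" for X :: "real^'n^'n"
proof -
  have "\<exists>K>0. \<forall>(a :: real^'n^'n) (b :: real^'n^'n). norm (a ** b) \<le> norm a * norm b * K"
    by (rule mm.pos_bounded)
  then obtain K where K0: "K > 0 \<and> (\<forall>(a :: real^'n^'n) (b :: real^'n^'n). norm (a ** b) \<le> norm a * norm b * K)"
    by blast
  have K: "K > 0" using K0 by (rule conjunct1)
  have K2: "norm (a ** b) \<le> norm a * norm b * K" for a b :: "real^'n^'n"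
    using K0[THEN conjunct2] by (elim allE)
  have "norm (mpow X k) \<le> (norm X * K) ^ k * norm (mat 1 :: real^'n^'n)" for k
  proof (induction k)
    case (Suc k)
    have "norm (mpow X (Suc k)) \<le> norm X * norm (mpow X k) * K"
      unfolding mpow_Suc by (rule K2)
    also have "\<dots> = norm X * K * norm (mpow X k)" by (simp only: mult_ac)
    also have "\<dots> \<le> norm X * K * ((norm X * K) ^ k * norm (mat 1 :: real^'n^'n))"
      by (rule mult_left_mono[OF Suc]) (use K in simp)
    finally show ?case by (simp only: power_Suc mult.assoc)
  next
    case 0
    show ?case by (simp only: mpow_def funpow_0 power_0 mult_1_left order_refl)
  qed
  moreover have "norm X * K \<ge> 0" using K by simp
  ultimately show ?thesis by (intro exI[of _ "norm X * K"] conjI allI)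
qed

lemma summable_mexp: "summable (\<lambda>k. (1 / fact k) *\<^sub>R mpow X k)" for X :: "real^'n^'n"
proof -
  obtain C where C: "C \<ge> 0" "\<And>k. norm (mpow X k) \<le> C ^ k * norm (mat 1 :: real^'n^'n)"
    using mpow_bound[of X] by blast
  have "summable (\<lambda>k. (inverse (fact k) * C ^ k) * norm (mat 1 :: real^'n^'n))"
    by (rule summable_mult2[OF summable_exp])
  then show ?thesis
  proof (rule summable_comparison_test'[where N = 0])
    show "norm ((1 / fact k) *\<^sub>R mpow X k) \<le> inverse (fact k) * C ^ k * norm (mat 1 :: real^'n^'n)" for k
      using C(2)[of k] by (simp add: divide_simps)
  qed
qed

text \<open>Each entry of exp(tX) becomes a real power series in t, so that termwise differentiation
  of real power series applies.\<close>

lemma mexp_scaleR_nth: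
  fixes X :: "real^'n^'n"
  shows "summable (\<lambda>k. (mpow X k $ i $ j / fact k) * t ^ k)" (is "summable ?f")
    and "mexp (t *\<^sub>R X) $ i $ j = (\<Sum>k. (mpow X k $ i $ j / fact k) * t ^ k)"
proof -
  let ?g = "\<lambda>k. (1 / fact k) *\<^sub>R mpow (t *\<^sub>R X) k"
  have lin: "bounded_linear (\<lambda>A :: real^'n^'n. A $ i $ j)"
    by (rule bounded_linear_compose[OF bounded_linear_vec_nth bounded_linear_vec_nth])
  have s: "summable ?g" by (rule summable_mexp)
  have eq: "?g k $ i $ j = ?f k" for k by (simp add: mpow_scaleR)
  note [simp del] = vector_scaleR_component
  show "summable ?f" using bounded_linear.summable[OF lin s] by (simp add: eq)
  have "mexp (t *\<^sub>R X) = (\<Sum>k. ?g k)" by (simp add: mexp_def mpow_def)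
  then show "mexp (t *\<^sub>R X) $ i $ j = (\<Sum>k. ?f k)"
    using bounded_linear.suminf[OF lin s] by (simp add: eq)
qed

lemma has_vector_derivative_matrix:
  fixes f :: "real \<Rightarrow> real^'n^'m"
  assumes "\<And>i j. ((\<lambda>t. f t $ i $ j) has_real_derivative f' $ i $ j) (at t)"
  shows "(f has_vector_derivative f') (at t)"
  unfolding has_vector_derivative_def has_derivative_componentwise_within[of f]
  using assms by (auto simp: Basis_vec_def inner_axis has_field_derivative_def mult_commute_abs)

lemma mexp_derivative: "((\<lambda>t. mexp (t *\<^sub>R X)) has_vector_derivative X ** mexp (t *\<^sub>R X)) (at t)"
proof (rule has_vector_derivative_matrix)
  fix i j
  let ?c = "\<lambda>i k. mpow X k $ i $ j / fact k"
  have "((\<lambda>t. \<Sum>k. ?c i k * t ^ k) has_field_derivative (\<Sum>k. diffs (?c i) k * t ^ k)) (at t)"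
    by (rule termdiffs_strong_converges_everywhere) (rule mexp_scaleR_nth)
  moreover have "(\<Sum>k. diffs (?c i) k * t ^ k) = (X ** mexp (t *\<^sub>R X)) $ i $ j"
  proof -
    \<comment> \<open>Since (k + 1) / (k + 1)! = 1 / k!, the shifted coefficient is the (i, j)-entry
      of \<open>X ** mpow X k\<close> divided by k!.\<close>
    have d: "diffs (?c i) k = (\<Sum>l\<in>UNIV. X $ i $ l * ?c l k)" for k
    proof -
      have "diffs (?c i) k = mpow X (Suc k) $ i $ j / fact k"
        unfolding diffs_def by (simp add: divide_simps del: of_nat_Suc)
      then show ?thesis
        by (simp add: mpow_Suc matrix_matrix_mult_def sum_divide_distrib)
    qed
    have "(\<Sum>k. diffs (?c i) k * t ^ k) = (\<Sum>k. \<Sum>l\<in>UNIV. X $ i $ l * (?c l k * t ^ k))"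
      by (simp add: d sum_distrib_right mult.assoc)
    also have "\<dots> = (\<Sum>l\<in>UNIV. \<Sum>k. X $ i $ l * (?c l k * t ^ k))"
      by (rule suminf_sum) (intro summable_mult mexp_scaleR_nth)
    also have "\<dots> = (\<Sum>l\<in>UNIV. X $ i $ l * mexp (t *\<^sub>R X) $ l $ j)"
      unfolding mexp_scaleR_nth(2) by (intro sum.cong refl suminf_mult mexp_scaleR_nth)
    finally show ?thesis by (simp add: matrix_matrix_mult_def)
  qed
  ultimately show "((\<lambda>t. mexp (t *\<^sub>R X) $ i $ j) has_real_derivative (X ** mexp (t *\<^sub>R X)) $ i $ j) (at t)"
    by (simp add: mexp_scaleR_nth)
qed

lemma mexp_zero: "mexp 0 = mat 1"
proof -
  have "mexp (0 *\<^sub>R (0::real^'n^'n)) $ i $ j = (mat 1 :: real^'n^'n) $ i $ j" for i j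
    unfolding mexp_scaleR_nth using powser_zero[of "\<lambda>k. mpow (0::real^'n^'n) k $ i $ j / fact k"]
    by (simp add: mpow_def)
  then show ?thesis by (intro vec_eq_iff[THEN iffD2] allI) (simp only: scaleR_zero_right)
qed

text \<open>With E = exp(tX), the derivative of E^T E is E^T (X^T + X) E = 0, so E stays orthogonal.
  Its determinant is then a continuous function of t with values in {-1, 1} and equals 1 at t =
  0.\<close>

lemma mexp_in_SO:
  assumes "X \<in> so" shows "mexp (t *\<^sub>R X) \<in> SO"
proof -
  let ?E = "\<lambda>t. mexp (t *\<^sub>R X)"
  have "((\<lambda>t. transpose (?E t) ** ?E t) has_vector_derivative
      transpose (?E t) ** (X ** ?E t) + transpose (X ** ?E t) ** ?E t) (at t)" for t
    by (intro mm.has_vector_derivative mexp_derivative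
        bounded_linear.has_vector_derivative[OF linear_linear[THEN iffD2, OF linear_transpose]])
  moreover have "transpose (?E t) ** (X ** ?E t) + transpose (X ** ?E t) ** ?E t = 0" for t
    using assms by (simp add: so_iff matrix_transpose_mul mm_simps matrix_mul_assoc)
  ultimately have z: "((\<lambda>t. transpose (?E t) ** ?E t) has_vector_derivative 0) (at t)" for t
    by (simp only:)
  obtain c where c: "transpose (?E t) ** ?E t = c" for t
    by (rule has_vector_derivative_zero_constant[of UNIV "\<lambda>t. transpose (?E t) ** ?E t"])
      (use z in \<open>simp_all\<close>)
  have "c = mat 1" unfolding c[of 0, symmetric] by (simp add: mexp_zero)
  then have o: "transpose (?E t) ** ?E t = mat 1" for t using c[of t] by (rule trans[rotated])
  have "continuous_on UNIV ?E"
    by (intro continuous_at_imp_continuous_on ballI has_vector_derivative_continuous[OF mexp_derivative])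
  then have "continuous_on UNIV (\<lambda>t. det (?E t))"
    unfolding det_def by (intro continuous_intros)
  then have "connected ((\<lambda>t. det (?E t)) ` UNIV)"
    by (rule connected_continuous_image) simp
  moreover have "(\<lambda>t. det (?E t)) ` UNIV \<subseteq> {-1, 1}"
  proof (rule image_subsetI)
    fix u
    have "orthogonal_matrix (?E u)" using o[of u] by (simp only: orthogonal_matrix)
    then show "det (?E u) \<in> {-1, 1}" using det_orthogonal_matrix[of "?E u"] by blast
  qed
  then have "finite ((\<lambda>t. det (?E t)) ` UNIV)"
    by (rule finite_subset) simp
  ultimately have "range (\<lambda>t. det (?E t)) = {} \<or> (\<exists>d. range (\<lambda>t. det (?E t)) = {d})"
    using connected_finite_iff_sing[of "range (\<lambda>t. det (?E t))"] by (simp only:)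
  then obtain d where d: "range (\<lambda>t. det (?E t)) = {d}"
    by blast
  have "det (?E t) = d" for t
    using rangeI[of "\<lambda>t. det (?E t)" t] unfolding d by (rule singletonD)
  from this[of t] this[of 0] have "det (?E t) = 1" by (simp add: mexp_zero)
  then show ?thesis using o[of t] by (simp only: SO_iff)
qed

lemma mexp_derivative_0:
  fixes a X :: "real^'n^'n"
  shows "((\<lambda>t. a ** mexp (t *\<^sub>R X)) has_vector_derivative a ** X) (at 0)"
  using bounded_linear.has_vector_derivative[OF mm.bounded_linear_right mexp_derivative[of X 0], of a]
  by (simp add: mexp_zero)

section \<open>Smoothness\<close>

lemma Ck_on_const: "Ck_on k U (\<lambda>x. c)"
  by (induction k arbitrary: c) simp_all

lemma frechet_derivative_bounded_linear:
  "bounded_linear f \<Longrightarrow> frechet_derivative f (at x) = f"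
  by (rule frechet_derivative_at[symmetric]) (rule bounded_linear_imp_has_derivative)

lemma bounded_linear_differentiable: "bounded_linear f \<Longrightarrow> f differentiable (at x)"
  unfolding differentiable_def by (rule exI) (rule bounded_linear_imp_has_derivative)

lemma Ck_on_bounded_linear: "bounded_linear f \<Longrightarrow> Ck_on k U f"
  by (cases k)
    (simp_all add: Ck_on_const frechet_derivative_bounded_linear bounded_linear_differentiable
      linear_continuous_on)

text \<open>The derivative in a fixed direction is linear in the base point, so the case of linear
  maps handles all further derivatives. The test functions and the explicit vector fields below are
  built from quadratic maps.\<close>

lemma Ck_on_quadratic:
  assumes "bounded_bilinear b" shows "Ck_on k U (\<lambda>x. b x x)"
proof -
  interpret bounded_bilinear b by fact
  have d: "((\<lambda>x. b x x) has_derivative (\<lambda>v. b x v + b v x)) (at x)" for x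
    by (rule FDERIV[OF has_derivative_ident has_derivative_ident])
  have l: "bounded_linear (\<lambda>x. b x v + b v x)" for v
    by (intro bounded_linear_add bounded_linear_left bounded_linear_right)
  show ?thesis
  proof (cases k)
    case 0
    then show ?thesis
      by (auto intro!: continuous_at_imp_continuous_on has_derivative_continuous[OF d])
  next
    case (Suc m)
    have "frechet_derivative (\<lambda>x. b x x) (at x) = (\<lambda>v. b x v + b v x)" for x
      by (rule frechet_derivative_at[OF d, symmetric])
    moreover have "(\<lambda>x. b x x) differentiable (at x)" for x
      unfolding differentiable_def by (rule exI) (rule d)
    ultimately show ?thesis using Suc by (simp add: Ck_on_bounded_linear l)
  qed
qed

text \<open>Derivatives are local, and \<open>U\<close> is open, so they agree on \<open>U\<close>
  again. Both functions are generalized in the induction because it passes to their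
  derivatives.\<close>

lemma Ck_on_cong:
  assumes "open U" "\<And>x. x \<in> U \<Longrightarrow> f x = g x" "Ck_on k U f"
  shows "Ck_on k U g"
  using assms(2,3)
proof (induction k arbitrary: f g)
  case 0
  then show ?case by (simp cong: continuous_on_cong)
next
  case (Suc k)
  have d: "(g has_derivative frechet_derivative f (at x)) (at x)" if "x \<in> U" for x
  proof (rule has_derivative_transform_within_open[OF _ assms(1) that])
    show "(f has_derivative frechet_derivative f (at x)) (at x)"
      using Suc.prems(2) that by (simp add: frechet_derivative_works)
  qed (rule Suc.prems(1))
  then have e: "frechet_derivative g (at x) = frechet_derivative f (at x)" if "x \<in> U" for x
    using that by (intro frechet_derivative_at[symmetric])
  have "Ck_on k U (\<lambda>x. frechet_derivative g (at x) v)" for v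
    by (rule Suc.IH[of "\<lambda>x. frechet_derivative f (at x) v"]) (use Suc.prems(2) e in simp_all)
  moreover have "g differentiable (at x)" if "x \<in> U" for x
    unfolding differentiable_def by (rule exI) (rule d[OF that])
  ultimately show ?case by simp
qed

lemma Ck_on_linear_comp:
  assumes "open U" "bounded_linear L" "Ck_on k U f"
  shows "Ck_on k U (\<lambda>x. L (f x))"
  using assms(3)
proof (induction k arbitrary: f)
  case 0
  then show ?case by (simp add: bounded_linear.continuous_on[OF assms(2)])
next
  case (Suc k)
  have d: "((\<lambda>x. L (f x)) has_derivative (\<lambda>v. L (frechet_derivative f (at x) v))) (at x)"
    if "x \<in> U" for x
    by (rule bounded_linear.has_derivative[OF assms(2)])
      (use Suc.prems that in \<open>simp add: frechet_derivative_works\<close>)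
  then have e: "frechet_derivative (\<lambda>x. L (f x)) (at x) = (\<lambda>v. L (frechet_derivative f (at x) v))"
    if "x \<in> U" for x
    using that by (intro frechet_derivative_at[symmetric])
  have "Ck_on k U (\<lambda>x. frechet_derivative (\<lambda>x. L (f x)) (at x) v)" for v
  proof (rule Ck_on_cong[OF assms(1)])
    show "Ck_on k U (\<lambda>x. L (frechet_derivative f (at x) v))"
      by (rule Suc.IH) (use Suc.prems in simp)
  qed (simp add: e)
  moreover have "(\<lambda>x. L (f x)) differentiable (at x)" if "x \<in> U" for x
    unfolding differentiable_def by (rule exI) (rule d[OF that])
  ultimately show ?case by simp
qed

lemma smooth_on_SO_linear: "linear f \<Longrightarrow> smooth_on_SO f" for f :: "real^'n^'n \<Rightarrow> 'b::euclidean_space"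
  unfolding smooth_on_SO_def
  by (intro exI[of _ UNIV] exI[of _ f]) (simp add: Ck_on_bounded_linear linear_conv_bounded_linear)

lemma smooth_on_SO_quadratic:
  "bilinear b \<Longrightarrow> smooth_on_SO (\<lambda>a. b a a)" for b :: "real^'n^'n \<Rightarrow> _ \<Rightarrow> 'b::euclidean_space"
  unfolding smooth_on_SO_def
  by (intro exI[of _ UNIV] exI[of _ "\<lambda>a. b a a"]) (simp add: Ck_on_quadratic bilinear_conv_bounded_bilinear)

lemma smooth_on_SO_linear_comp:
  fixes f :: "real^'n^'n \<Rightarrow> 'b::euclidean_space" and L :: "'b \<Rightarrow> 'c::euclidean_space"
  assumes "linear L" "smooth_on_SO f"
  shows "smooth_on_SO (\<lambda>a. L (f a))"
proof -
  obtain U E where U: "open U" "SO \<subseteq> U" "\<And>k. Ck_on k U E" "\<And>a. a \<in> SO \<Longrightarrow> f a = E a"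
    using assms(2) unfolding smooth_on_SO_def by blast
  have L: "bounded_linear L" using assms(1) by (simp add: linear_conv_bounded_linear)
  show ?thesis
    unfolding smooth_on_SO_def
    by (intro exI[of _ U] exI[of _ "\<lambda>x. L (E x)"] conjI allI ballI U Ck_on_linear_comp[OF U(1) L])
      (simp add: U(4))
qed

text \<open>The curve never leaves \<open>SO\<close>, where \<open>F\<close> agrees with its ambient
  smooth extension, so the chain rule for the extension applies.\<close>

lemma smooth_on_SO_derivative:
  fixes F :: "real^'n^'n \<Rightarrow> 'b::real_normed_vector"
  assumes "smooth_on_SO F" "a \<in> SO" "X \<in> so"
  shows "\<exists>w. ((\<lambda>t. F (a ** mexp (t *\<^sub>R X))) has_vector_derivative w) (at 0)"
proof -
  obtain U E where U: "open U" "SO \<subseteq> U" "\<And>k. Ck_on k U E" "\<And>a. a \<in> SO \<Longrightarrow> F a = E a"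
    using assms(1) unfolding smooth_on_SO_def by blast
  let ?c = "\<lambda>t. a ** mexp (t *\<^sub>R X)"
  have "a \<in> U" using U(2) assms(2) by blast
  then have "E differentiable (at a)" using U(3)[of "Suc 0"] by simp
  then have "(E has_derivative frechet_derivative E (at a)) (at (?c 0))"
    by (simp add: frechet_derivative_works mexp_zero)
  moreover have "(?c has_derivative (\<lambda>t. t *\<^sub>R (a ** X))) (at 0)"
    using mexp_derivative_0[of a X] by (simp only: has_vector_derivative_def)
  ultimately have d: "((\<lambda>t. E (?c t)) has_derivative (\<lambda>t. frechet_derivative E (at a) (t *\<^sub>R (a ** X)))) (at 0)"
    by (rule has_derivative_compose[rotated])
  have "linear (frechet_derivative E (at a))"
    by (rule linear_frechet_derivative) fact
  with d have "((\<lambda>t. E (?c t)) has_vector_derivative frechet_derivative E (at a) (a ** X)) (at 0)"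
    by (simp add: has_vector_derivative_def linear_cmul)
  moreover have "(\<lambda>t. F (?c t)) = (\<lambda>t. E (?c t))"
    by (intro ext U(4) SO_mult mexp_in_SO assms)
  ultimately show ?thesis by (simp only:) (rule exI)
qed

section \<open>Blocks of size 1, 2 and n - 3\<close>

datatype part = One | Two | Rest

text \<open>Replaces conditions on indices by case distinctions over three values. For n \<ge> 4 the
  default \<open>Rest\<close> consists exactly of the tail coordinates, see
  \<open>cls_iff\<close>.\<close>

definition cls :: "'n::finite \<Rightarrow> part" where
  "cls i = (if i = coord 1 then One else if i = coord 2 \<or> i = coord 3 then Two else Rest)"

text \<open>Keeping the (k, l) and the (l, k) entries together gives an orthogonal projection that
  commutes with the transpose. The three pairs of distinct parts give the projections of
  \<open>so\<close> onto \<open>\<mm>1\<close>, \<open>\<mm>2\<close> and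
  \<open>\<mm>3\<close>.\<close>

definition block :: "part \<Rightarrow> part \<Rightarrow> ('n::finite) sqmat \<Rightarrow> 'n sqmat" where
  "block k l X = (\<chi> i j. if (cls i = k \<and> cls j = l) \<or> (cls i = l \<and> cls j = k) then X $ i $ j else 0)"

definition block_diag :: "('n::finite) sqmat \<Rightarrow> bool" where
  "block_diag X \<longleftrightarrow> (\<forall>i j. cls i \<noteq> cls j \<longrightarrow> X $ i $ j = 0)"

lemma block_nth: "block k l X $ i $ j =
    (if (cls i = k \<and> cls j = l) \<or> (cls i = l \<and> cls j = k) then X $ i $ j else 0)"
  by (simp add: block_def)

lemma linear_block: "linear (block k l)"
  by (rule linearI) (simp_all add: vec_eq_iff block_nth)

lemmas block_linear_simps = linear_add[OF linear_block] linear_diff[OF linear_block]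
  linear_neg[OF linear_block] linear_cmul[OF linear_block] linear_0[OF linear_block]

lemma transpose_nth: "transpose X $ i $ j = X $ j $ i"
  by (simp add: transpose_def)

lemma matrix_mult_nth: "(X ** Y) $ i $ j = (\<Sum>k\<in>UNIV. X $ i $ k * Y $ k $ j)"
  by (simp add: matrix_matrix_mult_def)

lemma block_transpose: "block k l (transpose X) = transpose (block k l X)"
  by (auto simp: vec_eq_iff block_nth transpose_nth)

lemma block_in_so: "X \<in> so \<Longrightarrow> block k l X \<in> so"
  by (simp add: so_iff block_transpose[symmetric] block_linear_simps)

lemma block_sym: "block k l = block l k"
  by (auto simp: fun_eq_iff vec_eq_iff block_nth)

lemma inner_block: "block k l X \<bullet> Y = X \<bullet> block k l Y"
  unfolding inner_matrix by (rule sum.cong[OF refl], rule sum.cong[OF refl]) (simp add: block_nth)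

lemma block_block: "block k l (block k l X) = block k l X"
  by (simp add: vec_eq_iff block_nth)

text \<open>In a nonzero term of the product the summation index must have the class
  \<open>l\<close> common to both factors, which leaves only the classes \<open>k\<close> for the
  row and \<open>m\<close> for the column.\<close>

lemma block_block_mult:
  assumes "k \<noteq> l" "l \<noteq> m" "k \<noteq> m"
  shows "block k m (block k l X ** block l m Y) = block k l X ** block l m Y"
proof -
  have "(\<Sum>p\<in>UNIV. block k l X $ i $ p * block l m Y $ p $ j) = 0"
    if "\<not> ((cls i = k \<and> cls j = m) \<or> (cls i = m \<and> cls j = k))" for i j
    by (rule sum.neutral) (use assms that in \<open>auto simp: block_nth\<close>)
  then show ?thesis by (simp add: vec_eq_iff block_nth[of k m] matrix_mult_nth)
qed

lemma block_commutator:
  assumes "k \<noteq> l" "l \<noteq> m" "k \<noteq> m"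
  shows "block k m (commutator (block k l X) (block l m Y)) = commutator (block k l X) (block l m Y)"
  using block_block_mult[of m l k Y X] block_block_mult[OF assms, of X Y] assms
  by (simp add: commutator_def block_linear_simps block_sym[of m k] block_sym[of m l] block_sym[of l k])

text \<open>Each factor moves an index between the classes \<open>k\<close> and \<open>l\<close>;
  two such moves lead back to the class of the start.\<close>

lemma block_diag_commutator:
  assumes "k \<noteq> l" shows "block_diag (commutator (block k l X) (block k l Y))"
proof -
  have "(\<Sum>p\<in>UNIV. block k l X $ i $ p * block k l Y $ p $ j) = 0"
    if ij: "cls i \<noteq> cls j" for i j and X Y :: "real^'a^'a"
  proof (intro sum.neutral ballI)
    fix p :: 'a
    have "block k l X $ i $ p = 0 \<or> block k l Y $ p $ j = 0"
    proof (rule ccontr)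
      assume "\<not> ?thesis"
      then have "(cls i = k \<and> cls p = l) \<or> (cls i = l \<and> cls p = k)"
        "(cls p = k \<and> cls j = l) \<or> (cls p = l \<and> cls j = k)"
        unfolding block_nth by meson+
      with assms ij show False by metis
    qed
    then show "block k l X $ i $ p * block k l Y $ p $ j = 0" by simp
  qed
  then show ?thesis by (simp add: block_diag_def commutator_def matrix_mult_nth)
qed

section \<open>Projections onto the three summands and brackets between them\<close>

abbreviation p1 :: "('n::finite) sqmat \<Rightarrow> 'n sqmat" where "p1 \<equiv> block One Two"
abbreviation p2 :: "('n::finite) sqmat \<Rightarrow> 'n sqmat" where "p2 \<equiv> block Two Rest"
abbreviation p3 :: "('n::finite) sqmat \<Rightarrow> 'n sqmat" where "p3 \<equiv> block One Rest"

text \<open>On \<open>so\<close> this is the projection onto \<mm> along the Lie algebra of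
  \<open>H\<close>, as it deletes exactly the diagonal blocks.\<close>

definition pm :: "('n::finite) sqmat \<Rightarrow> 'n sqmat" where
  "pm X = p1 X + p2 X + p3 X"

lemma pm_nth: "pm X $ i $ j = (if cls i = cls j then 0 else X $ i $ j)"
  by (cases "cls i"; cases "cls j"; simp add: pm_def block_nth)

lemma p_p:
  "p1 (p2 X) = 0" "p1 (p3 X) = 0" "p2 (p1 X) = 0" "p2 (p3 X) = 0" "p3 (p1 X) = 0" "p3 (p2 X) = 0"
  by (simp_all add: vec_eq_iff block_nth)

lemma linear_pm: "linear pm"
  by (rule linearI) (simp_all add: vec_eq_iff pm_nth)

lemma p_of_commutator:
  "p1 (commutator (p2 X) (p3 Y)) = commutator (p2 X) (p3 Y)"
  "p1 (commutator (p3 X) (p2 Y)) = commutator (p3 X) (p2 Y)"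
  "p2 (commutator (p1 X) (p3 Y)) = commutator (p1 X) (p3 Y)"
  "p2 (commutator (p3 X) (p1 Y)) = commutator (p3 X) (p1 Y)"
  "p3 (commutator (p1 X) (p2 Y)) = commutator (p1 X) (p2 Y)"
  "p3 (commutator (p2 X) (p1 Y)) = commutator (p2 X) (p1 Y)"
  using block_commutator[of Two Rest One X Y] block_commutator[of One Rest Two X Y]
    block_commutator[of Two One Rest X Y] block_commutator[of Rest One Two X Y]
    block_commutator[of One Two Rest X Y] block_commutator[of Rest Two One X Y]
  by (simp_all add: block_sym[of Two One] block_sym[of Rest One] block_sym[of Rest Two])

lemma pm_p: "pm (p1 X) = p1 X" "pm (p2 X) = p2 X" "pm (p3 X) = p3 X"
  by (simp_all add: vec_eq_iff pm_nth block_nth)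

lemma pm_block_diag: "block_diag X \<Longrightarrow> pm X = 0"
  by (simp add: vec_eq_iff pm_nth block_diag_def)

lemma pm_commutator_p:
  "pm (commutator (p1 X) (p1 Y)) = 0"
  "pm (commutator (p2 X) (p2 Y)) = 0"
  "pm (commutator (p3 X) (p3 Y)) = 0"
  "pm (commutator (p2 X) (p3 Y)) = commutator (p2 X) (p3 Y)"
  "pm (commutator (p3 X) (p2 Y)) = commutator (p3 X) (p2 Y)"
  "pm (commutator (p1 X) (p3 Y)) = commutator (p1 X) (p3 Y)"
  "pm (commutator (p3 X) (p1 Y)) = commutator (p3 X) (p1 Y)"
  "pm (commutator (p1 X) (p2 Y)) = commutator (p1 X) (p2 Y)"
  "pm (commutator (p2 X) (p1 Y)) = commutator (p2 X) (p1 Y)"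
  using pm_p(1)[of "commutator (p2 X) (p3 Y)"] pm_p(1)[of "commutator (p3 X) (p2 Y)"]
    pm_p(2)[of "commutator (p1 X) (p3 Y)"] pm_p(2)[of "commutator (p3 X) (p1 Y)"]
    pm_p(3)[of "commutator (p1 X) (p2 Y)"] pm_p(3)[of "commutator (p2 X) (p1 Y)"]
  by (simp_all add: pm_block_diag block_diag_commutator p_of_commutator)

text \<open>Of the nine brackets between summands, the three of a summand with itself are block
  diagonal and vanish under \<open>pm\<close>; the other six already lie in some summand.\<close>

lemma pm_commutator:
  "pm (commutator (pm X) (pm Y)) =
     commutator (p2 X) (p3 Y) + commutator (p3 X) (p2 Y) +
     commutator (p1 X) (p3 Y) + commutator (p3 X) (p1 Y) +
     commutator (p1 X) (p2 Y) + commutator (p2 X) (p1 Y)"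
  unfolding pm_def[of X] pm_def[of Y]
  by (simp add: commutator_linear_simps linear_add[OF linear_pm] pm_commutator_p)

section \<open>The automorphism\<close>

text \<open>With \<open>eps\<close> it describes \<open>B\<close> as a signed permutation matrix:
  the only nonzero entry of row i is \<open>eps i\<close>, in column \<open>sig i\<close>.
  Conjugation by \<open>B\<close> thereby gets the entrywise formula \<open>phi_nth\<close>.\<close>

definition sig :: "'n::finite \<Rightarrow> 'n" where
  "sig i = (if i = coord 2 then coord 3 else if i = coord 3 then coord 2 else i)"

definition eps :: "'n::finite \<Rightarrow> real" where
  "eps i = (if i = coord 1 \<or> i = coord 2 then 1 else - 1)"

context
  assumes card4: "4 \<le> CARD('n::finite)"
begin

lemma bij_coord: "bij_betw (coord :: nat \<Rightarrow> 'n) {1..CARD('n)} UNIV"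
proof -
  have "\<exists>e. bij_betw e {1..CARD('n)} (UNIV :: 'n set)"
    using ex_bij_betw_nat_finite_1[of "UNIV :: 'n set"] by simp
  then show ?thesis unfolding coord_def by (rule someI_ex)
qed

lemma coord_eq_iff: "i \<in> {1..CARD('n)} \<Longrightarrow> j \<in> {1..CARD('n)} \<Longrightarrow> (coord i :: 'n) = coord j \<longleftrightarrow> i = j"
  by (rule inj_on_eq_iff[OF bij_betw_imp_inj_on[OF bij_coord]])

lemma coord_range: "1 \<in> {1..CARD('n)}" "2 \<in> {1..CARD('n)}" "3 \<in> {1..CARD('n)}" "4 \<in> {1..CARD('n)}"
  using card4 by simp_all

lemma coord_distinct:
  "(coord 1 :: 'n) \<noteq> coord 2" "(coord 2 :: 'n) \<noteq> coord 1" "(coord 1 :: 'n) \<noteq> coord 3"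
  "(coord 3 :: 'n) \<noteq> coord 1" "(coord 2 :: 'n) \<noteq> coord 3" "(coord 3 :: 'n) \<noteq> coord 2"
  by (simp_all add: coord_eq_iff[OF coord_range(1) coord_range(2)]
      coord_eq_iff[OF coord_range(2) coord_range(1)] coord_eq_iff[OF coord_range(1) coord_range(3)]
      coord_eq_iff[OF coord_range(3) coord_range(1)] coord_eq_iff[OF coord_range(2) coord_range(3)]
      coord_eq_iff[OF coord_range(3) coord_range(2)] del: One_nat_def)

declare coord_distinct [unfolded One_nat_def, simp]

lemma tail_iff: "i \<in> tail_coords \<longleftrightarrow> i \<noteq> coord 1 \<and> i \<noteq> coord 2 \<and> i \<noteq> coord 3" for i :: 'n
proof -
  have "i \<in> coord ` {1..CARD('n)}"
    by (simp only: bij_betw_imp_surj_on[OF bij_coord] UNIV_I)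
  then obtain k where k: "k \<in> {1..CARD('n)}" "i = coord k"
    by (elim imageE)
  have "{4..CARD('n)} \<subseteq> {1..CARD('n)}" by simp
  then have "i \<in> tail_coords \<longleftrightarrow> k \<in> {4..CARD('n)}"
    unfolding tail_coords_def k(2)
    by (rule inj_on_image_mem_iff[OF bij_betw_imp_inj_on[OF bij_coord] k(1)])
  moreover have "k \<in> {4..CARD('n)} \<longleftrightarrow> k \<noteq> 1 \<and> k \<noteq> 2 \<and> k \<noteq> 3"
    using k(1) by auto
  ultimately show ?thesis
    unfolding k(2) coord_eq_iff[OF k(1) coord_range(1)] coord_eq_iff[OF k(1) coord_range(2)]
      coord_eq_iff[OF k(1) coord_range(3)] by simp
qed

lemma cls_simps:
  "cls (coord 1 :: 'n) = One" "cls (coord 2 :: 'n) = Two" "cls (coord 3 :: 'n) = Two"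
  by (simp_all add: cls_def)

declare cls_simps [unfolded One_nat_def, simp]

lemma cls_iff: "cls i = One \<longleftrightarrow> i = coord 1" "cls i = Two \<longleftrightarrow> i = coord 2 \<or> i = coord 3"
  "cls i = Rest \<longleftrightarrow> i \<in> tail_coords" for i :: 'n
  unfolding tail_iff by (auto simp: cls_def)

lemma cls_coord4: "cls (coord 4 :: 'n) = Rest"
  unfolding cls_iff tail_coords_def using card4 by auto

lemma sig_sig [simp]: "sig (sig i) = (i :: 'n)"
  by (auto simp: sig_def)

lemma sig_eq_iff [simp]: "sig i = sig j \<longleftrightarrow> i = (j :: 'n)"
  by (auto simp: sig_def)

lemma cls_sig [simp]: "cls (sig i) = cls (i :: 'n)"
  by (auto simp: sig_def)

lemma eps_mult [simp]: "eps i * eps i = 1"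
  by (simp add: eps_def)

text \<open>These are the diagonal entries of B^2 = diag(1, -1, -1, 1, ..., 1).\<close>

lemma eps_sig: "eps i * eps (sig i) = (if cls i = Two then - 1 else 1)" for i :: 'n
  by (auto simp: eps_def sig_def cls_def)

lemma B_nth: "B $ i $ j = (if j = sig i then eps i else 0)" for i j :: 'n
  by (auto simp: B_def sig_def eps_def tail_iff)

lemma B_mult_nth: "(B ** X) $ i $ j = eps i * X $ sig i $ j" for X :: "'n sqmat"
proof -
  have "B $ i $ k * X $ k $ j = (if k = sig i then eps i * X $ k $ j else 0)" for k
    by (simp add: B_nth)
  then show ?thesis by (simp add: matrix_mult_nth)
qed

lemma mult_transpose_B_nth: "(X ** transpose B) $ i $ j = eps j * X $ i $ sig j" for X :: "'n sqmat"
  by (simp add: matrix_mult_nth transpose_nth B_nth if_distrib sum.delta cong: if_cong)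

lemma B_orth: "transpose B ** B = (mat 1 :: 'n sqmat)" "B ** transpose B = (mat 1 :: 'n sqmat)"
proof -
  show "B ** transpose B = (mat 1 :: 'n sqmat)"
    by (simp add: vec_eq_iff mult_transpose_B_nth B_nth mat_def sig_eq_iff)
  then show "transpose B ** B = (mat 1 :: 'n sqmat)"
    by (simp add: matrix_left_right_inverse)
qed

lemma Phi_eq: "Phi X = B ** X ** transpose B" for X :: "'n sqmat"
  by (simp add: Phi_def matrix_inv_orthogonal B_orth)

lemma linear_Phi: "linear (Phi :: 'n sqmat \<Rightarrow> _)"
  by (rule linearI) (simp_all add: Phi_eq mm_simps)

text \<open>A linear map is its own derivative.\<close>

lemma phi_eq_Phi: "phi = (Phi :: 'n sqmat \<Rightarrow> _)"
  unfolding phi_def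
  by (rule frechet_derivative_bounded_linear) (simp add: linear_Phi flip: linear_conv_bounded_linear)

lemma phi_eq: "phi X = B ** X ** transpose B" for X :: "'n sqmat"
  by (simp add: Phi_eq phi_eq_Phi)

lemma linear_phi: "linear (phi :: 'n sqmat \<Rightarrow> _)"
  by (simp add: linear_Phi phi_eq_Phi)

lemma phi_nth: "phi X $ i $ j = eps i * eps j * X $ sig i $ sig j" for X :: "'n sqmat"
  by (simp add: phi_eq mult_transpose_B_nth B_mult_nth)

lemma phi_mult: "phi (X ** Y) = phi X ** phi Y" for X Y :: "'n sqmat"
proof -
  have "B ** X ** transpose B ** (B ** Y ** transpose B)
      = B ** X ** (transpose B ** B) ** Y ** transpose B"
    by (simp only: matrix_mul_assoc)
  then show ?thesis by (simp add: phi_eq B_orth matrix_mul_assoc)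
qed

lemma phi_transpose: "phi (transpose X) = transpose (phi X)" for X :: "'n sqmat"
  by (simp add: phi_eq matrix_transpose_mul matrix_mul_assoc)

lemmas phi_linear_simps = linear_add[OF linear_phi] linear_diff[OF linear_phi]
  linear_neg[OF linear_phi] linear_cmul[OF linear_phi] linear_0[OF linear_phi]

lemma phi_commutator: "phi (commutator X Y) = commutator (phi X) (phi Y)" for X Y :: "'n sqmat"
  by (simp add: commutator_def phi_linear_simps phi_mult)

lemma phi_in_so: "X \<in> so \<Longrightarrow> phi X \<in> so" for X :: "'n sqmat"
  by (simp add: so_iff phi_transpose[symmetric] phi_linear_simps)

lemma inner_phi: "phi X \<bullet> phi Y = X \<bullet> Y" for X Y :: "'n sqmat"
  by (simp add: phi_eq inner_conj_orthogonal B_orth)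

lemma phi_block: "phi (block k l X) = block k l (phi X)" for X :: "'n sqmat"
  by (simp add: vec_eq_iff phi_nth block_nth)

text \<open>The square of \<open>phi\<close> is conjugation by the diagonal matrix B^2 and only
  changes signs: exactly the entries with one index in {2, 3} and one outside are negated.\<close>

lemma phi_phi_nth: "phi (phi X) $ i $ j =
    (if cls i = Two then - 1 else 1) * (if cls j = Two then - 1 else 1) * X $ i $ j" for X :: "'n sqmat"
proof -
  have "phi (phi X) $ i $ j = (eps i * eps (sig i)) * (eps j * eps (sig j)) * X $ i $ j"
    by (simp add: phi_nth mult_ac)
  then show ?thesis by (simp only: eps_sig)
qed

lemma phi_phi_p1: "phi (phi (p1 X)) = - p1 X" for X :: "'n sqmat"
  by (auto simp: vec_eq_iff phi_phi_nth block_nth)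

lemma phi_phi_p2: "phi (phi (p2 X)) = - p2 X" for X :: "'n sqmat"
  by (auto simp: vec_eq_iff phi_phi_nth block_nth)

lemma phi_p3: "phi (p3 X) = - p3 X" for X :: "'n sqmat"
  by (auto simp: vec_eq_iff phi_nth block_nth cls_def sig_def eps_def)

lemma phi_pow4: "phi (phi (phi (phi X))) = X" for X :: "'n sqmat"
  by (auto simp: vec_eq_iff phi_phi_nth)

text \<open>The (1, 1)-entry is untouched, the signs on the tail block cancel, and a skew 2 x 2
  block commutes with a plane rotation. Hence \<open>phi Y - Y\<close> has no diagonal
  blocks.\<close>

lemma phi_block_diag:
  fixes X :: "'n sqmat"
  assumes "X \<in> so" "cls i = cls j" shows "phi X $ i $ j = X $ i $ j"
proof -
  have s: "X $ a $ b = - X $ b $ a" for a b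
  proof -
    have "transpose X $ b $ a = (- X) $ b $ a" using assms(1) by (simp only: so_iff)
    then show ?thesis by (simp add: transpose_nth)
  qed
  have d: "X $ a $ a = 0" for a using s[of a a] by simp
  show ?thesis using assms(2) s[of "coord 2" "coord 3"]
    by (auto simp: phi_nth cls_def sig_def eps_def d split: if_splits)
qed

section \<open>The reductive complement\<close>

lemma mm_iff: "X \<in> \<mm> \<longleftrightarrow> X \<in> so \<and> pm X = X" for X :: "'n sqmat"
proof
  assume "X \<in> \<mm>"
  then obtain Y where Y: "Y \<in> so" "X = phi Y - Y" unfolding \<mm>_def by blast
  then have "X \<in> so" by (simp add: subspace_so subspace_diff phi_in_so)
  moreover have "pm X = X" using Y by (auto simp: vec_eq_iff pm_nth phi_block_diag)
  ultimately show "X \<in> so \<and> pm X = X" ..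
next
  assume X: "X \<in> so \<and> pm X = X"
  let ?Z = "p1 X + p2 X"
  \<comment> \<open>An inverse of \<phi> - 1: where \<phi>^2 = -1 one has (\<phi> - 1)(\<phi> + 1) =
    -2, and on the third summand \<phi> - 1 is already -2.\<close>
  let ?Y = "- (1 / 2) *\<^sub>R (p3 X + (?Z + phi ?Z))"
  have "?Y \<in> so"
    using X by (intro subspace_scale subspace_add subspace_so block_in_so phi_in_so) auto
  moreover have "phi ?Y - ?Y = pm X"
  proof -
    have "phi (phi ?Z) = - ?Z" by (simp add: phi_linear_simps phi_phi_p1 phi_phi_p2)
    then have "phi ?Y = - (1 / 2) *\<^sub>R (- p3 X + (phi ?Z - ?Z))"
      by (simp only: phi_linear_simps(4) phi_linear_simps(1)[of "p3 X"] phi_linear_simps(1)[of ?Z]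
          phi_p3 diff_conv_add_uminus)
    moreover have "- (1 / 2) *\<^sub>R (- a + (w - z)) - (- (1 / 2)) *\<^sub>R (a + (z + w)) = z + a"
      for a w z :: "'n sqmat"
    proof -
      have "- (1 / 2) *\<^sub>R (- a + (w - z)) - (- (1 / 2)) *\<^sub>R (a + (z + w)) = (1 / 2) *\<^sub>R ((z + a) + (z + a))"
        by (simp add: scaleR_add_right scaleR_diff_right)
      then show ?thesis by (simp only: scaleR_half_double)
    qed
    ultimately show ?thesis by (simp only: pm_def)
  qed
  ultimately have "X = phi ?Y - ?Y" "?Y \<in> so" using X by (simp_all only:)
  then show "X \<in> \<mm>" unfolding \<mm>_def by (rule image_eqI)
qed

section \<open>The f-structure \<open>f0\<close> on matrices\<close>

lemma f0_eq: "f0 X = (1 / 2) *\<^sub>R (phi X - phi (phi (phi X)))" for X :: "'n sqmat"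
  by (simp add: f0_def numeral_3_eq_3)

lemma linear_f0: "linear (f0 :: 'n sqmat \<Rightarrow> _)"
  by (rule linearI) (simp_all add: f0_eq phi_linear_simps scaleR_add_right scaleR_diff_right mult.commute)

lemmas f0_linear_simps = linear_add[OF linear_f0] linear_diff[OF linear_f0]
  linear_neg[OF linear_f0] linear_cmul[OF linear_f0] linear_0[OF linear_f0]

text \<open>Where \<phi>^2 = -1, also \<phi>^3 = - \<phi>, so half of \<phi> - \<phi>^3 is
  \<phi>.\<close>

lemma f0_p1: "f0 (p1 X) = phi (p1 X)" for X :: "'n sqmat"
  by (simp add: f0_eq phi_phi_p1 phi_linear_simps flip: scaleR_2)

lemma f0_p2: "f0 (p2 X) = phi (p2 X)" for X :: "'n sqmat"
  by (simp add: f0_eq phi_phi_p2 phi_linear_simps flip: scaleR_2)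

lemma f0_p3: "f0 (p3 X) = 0" for X :: "'n sqmat"
  by (simp add: f0_eq phi_p3 phi_linear_simps)

lemma f0_block: "f0 (block k l X) = block k l (f0 X)" for X :: "'n sqmat"
  by (simp add: f0_eq phi_block block_linear_simps)

lemma pm_f0: "pm (f0 X) = f0 (pm X)" for X :: "'n sqmat"
  by (simp add: pm_def f0_linear_simps f0_block)

lemma f0_in_so: "X \<in> so \<Longrightarrow> f0 X \<in> so" for X :: "'n sqmat"
  unfolding f0_eq by (intro subspace_scale subspace_diff subspace_so phi_in_so)

lemma f0_in_mm: "X \<in> \<mm> \<Longrightarrow> f0 X \<in> \<mm>" for X :: "'n sqmat"
  by (simp add: mm_iff pm_f0 f0_in_so)

text \<open>As \<phi> is orthogonal with \<phi>^4 = 1, its adjoint is \<phi>^3, and passing to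
  adjoints exchanges the two terms of \<open>f0\<close>.\<close>

lemma f0_skew: "f0 X \<bullet> Y = - (X \<bullet> f0 Y)" for X Y :: "'n sqmat"
proof -
  have "phi X \<bullet> Y = X \<bullet> phi (phi (phi Y))"
    using inner_phi[of X "phi (phi (phi Y))"] by (simp add: phi_pow4)
  moreover have "phi (phi (phi X)) \<bullet> Y = X \<bullet> phi Y"
    using inner_phi[of "phi (phi (phi X))" Y] by (simp add: phi_pow4)
  ultimately show ?thesis
    by (simp add: f0_eq inner_diff_left inner_diff_right field_simps)
qed

lemma f0_phi: "f0 (phi X) = phi (f0 X)" for X :: "'n sqmat"
  by (simp add: f0_eq phi_linear_simps)

text \<open>From \<phi>^4 = 1 it follows that \<phi>^2 = -1 on the image of \<open>f0\<close>, so
  \<open>f0\<close> acts there as \<phi> and its square as -1.\<close>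

lemma f0_cube: "f0 (f0 (f0 X)) = - f0 X" for X :: "'n sqmat"
proof -
  have "phi (phi (f0 X)) = - f0 X"
    by (simp add: f0_eq phi_linear_simps phi_pow4) (simp add: scaleR_diff_right)
  then have "f0 (f0 X) = (1 / 2) *\<^sub>R (phi (f0 X) + phi (f0 X))"
    by (simp add: f0_eq[of "f0 X"] phi_linear_simps)
  then have 1: "f0 (f0 X) = phi (f0 X)" by (simp only: scaleR_half_double)
  have "f0 (f0 (f0 X)) = phi (f0 (f0 X))"
    unfolding 1 by (simp add: f0_phi 1)
  then show ?thesis using \<open>phi (phi (f0 X)) = - f0 X\<close> by (simp add: 1)
qed

lemma skew_supported_iff:
  "X \<in> skew_supported (\<lambda>i j. cls i = k \<and> cls j = l) \<longleftrightarrow> X \<in> so \<and> block k l X = X" for X :: "'n sqmat"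
proof -
  have "(X $ i $ j \<noteq> 0 \<longrightarrow> (cls i = k \<and> cls j = l) \<or> (cls j = k \<and> cls i = l)) \<longleftrightarrow>
      block k l X $ i $ j = X $ i $ j" for i j
    unfolding block_nth by (cases "X $ i $ j = 0") auto
  then show ?thesis by (simp add: skew_supported_def vec_eq_iff)
qed

lemma mm1_iff: "X \<in> \<mm>1 \<longleftrightarrow> X \<in> so \<and> p1 X = X"
  and mm2_iff: "X \<in> \<mm>2 \<longleftrightarrow> X \<in> so \<and> p2 X = X"
  and mm3_iff: "X \<in> \<mm>3 \<longleftrightarrow> X \<in> so \<and> p3 X = X" for X :: "'n sqmat"
  unfolding \<mm>1_def \<mm>2_def \<mm>3_def skew_supported_iff[symmetric]
  by (simp_all only: cls_iff insert_iff empty_iff simp_thms)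

end

section \<open>The Killing form\<close>

definition munit :: "'n \<Rightarrow> 'n \<Rightarrow> ('n::finite) sqmat" where
  "munit i j = axis i (axis j 1)"

lemma munit_nth: "munit i j $ k $ l = (if k = i \<and> l = j then 1 else 0)"
  by (auto simp: munit_def axis_def)

lemma transpose_munit: "transpose (munit i j) = munit j i"
  by (auto simp: vec_eq_iff transpose_nth munit_nth)

lemma inner_munit: "munit i j \<bullet> X = X $ i $ j"
  by (simp add: munit_def inner_axis')

lemma mult_munit_mult_nth: "(A ** munit i j ** C) $ k $ l = A $ k $ i * C $ j $ l"
proof -
  have "(A ** munit i j) $ k $ p = (if p = j then A $ k $ i else 0)" for p
  proof -
    have "A $ k $ q * munit i j $ q $ p = (if q = i then (if p = j then A $ k $ i else 0) else 0)" for q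
      by (simp add: munit_nth)
    then show ?thesis by (simp add: matrix_mult_nth)
  qed
  moreover have "(if p = j then A $ k $ i else 0) * C $ p $ l = (if p = j then A $ k $ i * C $ j $ l else 0)" for p
    by simp
  ultimately show ?thesis by (simp add: matrix_mult_nth[of "A ** munit i j"])
qed

text \<open>The trace does not depend on the orthonormal basis: it is the trace of \<open>L \<circ> P\<close> on
  the ambient matrix space, where \<open>P\<close> is the orthogonal projection onto \<open>V\<close>.\<close>

lemma trace_on_eq:
  fixes V :: "('n::finite) sqmat set"
  assumes V: "subspace V" and L: "linear L"
    and P: "\<And>X. P X \<in> V" "\<And>X. X \<in> V \<Longrightarrow> P X = X" "\<And>X Y. P X \<bullet> Y = X \<bullet> P Y"
  shows "trace_on V L = (\<Sum>i\<in>UNIV. \<Sum>j\<in>UNIV. L (P (munit i j)) $ i $ j)"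
proof -
  define b where "b = (SOME b. is_orthonormal_basis V b)"
  have "\<exists>b. is_orthonormal_basis V b"
    unfolding is_orthonormal_basis_def using orthonormal_basis_subspace[OF V] by metis
  then have b: "is_orthonormal_basis V b" unfolding b_def by (rule someI_ex)
  then have ob: "pairwise orthogonal b" and nb: "\<And>x. x \<in> b \<Longrightarrow> norm x = 1" and sb: "span b = V"
    by (auto simp: is_orthonormal_basis_def)
  have fin: "finite b" by (rule pairwise_orthogonal_imp_finite[OF ob])
  have bb: "x \<bullet> y = (if x = y then 1 else 0)" if "x \<in> b" "y \<in> b" for x y
    using ob nb that by (auto simp: pairwise_def orthogonal_def dot_square_norm)
  have exp: "P e = (\<Sum>x\<in>b. (e \<bullet> x) *\<^sub>R x)" for e
  proof -
    \<comment> \<open>The difference of the two sides lies in the span of \<open>b\<close> and is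
      orthogonal to \<open>b\<close>, hence orthogonal to itself.\<close>
    let ?d = "P e - (\<Sum>x\<in>b. (e \<bullet> x) *\<^sub>R x)"
    have "?d \<bullet> y = 0" if "y \<in> b" for y
    proof -
      have "y \<in> V" using sb that span_base by blast
      have "(\<Sum>x\<in>b. (e \<bullet> x) *\<^sub>R x) \<bullet> y = (\<Sum>x\<in>b. if x = y then e \<bullet> x else 0)"
        unfolding inner_sum_left by (rule sum.cong[OF refl]) (simp add: bb that)
      also have "\<dots> = e \<bullet> y" using fin that by simp
      finally show ?thesis using P(2)[OF \<open>y \<in> V\<close>] by (simp add: inner_diff_left P(3))
    qed
    moreover have "?d \<in> span b"
    proof (rule span_diff)
      show "P e \<in> span b" by (simp add: sb P(1))
      show "(\<Sum>x\<in>b. (e \<bullet> x) *\<^sub>R x) \<in> span b"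
        by (intro span_sum span_scale span_base)
    qed
    ultimately have "orthogonal ?d ?d"
      by (intro orthogonal_to_span[of ?d b]) (simp_all add: orthogonal_def)
    then show ?thesis by (simp add: orthogonal_def)
  qed
  have "L (P (munit i j)) $ i $ j = (\<Sum>x\<in>b. x $ i $ j * L x $ i $ j)" for i j
    unfolding exp inner_munit by (simp add: linear_sum[OF L] linear_cmul[OF L])
  then have "(\<Sum>i\<in>UNIV. \<Sum>j\<in>UNIV. L (P (munit i j)) $ i $ j)
      = (\<Sum>i\<in>UNIV. \<Sum>j\<in>UNIV. \<Sum>x\<in>b. x $ i $ j * L x $ i $ j)"
    by (simp only:)
  also have "\<dots> = (\<Sum>i\<in>UNIV. \<Sum>x\<in>b. \<Sum>j\<in>UNIV. x $ i $ j * L x $ i $ j)"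
    by (rule sum.cong[OF refl], rule sum.swap)
  also have "\<dots> = (\<Sum>x\<in>b. \<Sum>i\<in>UNIV. \<Sum>j\<in>UNIV. x $ i $ j * L x $ i $ j)"
    by (rule sum.swap)
  also have "\<dots> = (\<Sum>x\<in>b. L x \<bullet> x)"
    by (simp add: inner_matrix mult.commute)
  finally show ?thesis by (simp add: trace_on_def b_def)
qed

text \<open>The traces of Z \<mapsto> A Z C and of Z \<mapsto> A Z^T C on the full matrix space,
  computed on matrix units.\<close>

lemma sum_diag_sandwich:
  "(\<Sum>i\<in>UNIV. \<Sum>j\<in>UNIV. (A ** munit i j ** C) $ i $ j) = trace A * trace C"
  "(\<Sum>i\<in>UNIV. \<Sum>j\<in>UNIV. (A ** munit j i ** C) $ i $ j) = A \<bullet> C"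
  by (simp_all add: mult_munit_mult_nth trace_def sum_product inner_matrix)

lemma inner_mat_1: "A \<bullet> mat 1 = trace A" "mat 1 \<bullet> A = trace A" for A :: "('n::finite) sqmat"
  by (simp_all add: inner_matrix mat_def trace_def mult_delta_left mult_delta_right)

lemma trace_mult_skew:
  assumes "X \<in> so" shows "trace (X ** Y) = - (X \<bullet> Y)" "trace (Y ** X) = - (X \<bullet> Y)"
proof -
  have "trace (X ** Y) = (X ** Y) \<bullet> mat 1" by (simp add: inner_mat_1)
  also have "\<dots> = Y \<bullet> transpose X" by (metis inner_commute inner_mult_left matrix_mul_rid)
  finally show "trace (X ** Y) = - (X \<bullet> Y)" using assms by (simp add: so_iff inner_commute)
  then show "trace (Y ** X) = - (X \<bullet> Y)" by (simp add: trace_mul_sym[of Y X])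
qed

lemma trace_skew: "X \<in> so \<Longrightarrow> trace X = 0"
  using trace_mult_skew(1)[of X "mat 1"] by (simp add: inner_mat_1)

text \<open>The trace over \<open>so\<close> is half of tr L minus the trace of L composed with
  transposition. These are -2n (X \<bullet> Y) and -4 (X \<bullet> Y), which gives the factor -(n -
  2).\<close>

lemma killing_form_so:
  fixes X Y :: "('n::finite) sqmat"
  assumes "X \<in> so" "Y \<in> so"
  shows "killing_form X Y = - (real CARD('n) - 2) * (X \<bullet> Y)"
proof -
  define P where "P Z = (1 / 2) *\<^sub>R (Z - transpose Z)" for Z :: "'n sqmat"
  define L where "L Z = commutator X (commutator Y Z)" for Z
  have linL: "linear L"
    by (rule linearI) (simp_all add: L_def commutator_linear_simps)
  \<comment> \<open>Written as four terms A Z C, padded with \<open>mat 1\<close>, so that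
    \<open>sum_diag_sandwich\<close> evaluates each of them.\<close>
  have L: "L Z = (X ** Y) ** Z ** mat 1 - X ** Z ** Y - Y ** Z ** X + mat 1 ** Z ** (Y ** X)" for Z
    by (simp add: L_def commutator_def mm_simps matrix_mul_assoc)
  have "killing_form X Y = (\<Sum>i\<in>UNIV. \<Sum>j\<in>UNIV. L (P (munit i j)) $ i $ j)"
    unfolding killing_form_def L_def[symmetric]
  proof (rule trace_on_eq[OF subspace_so linL])
    show "P Z \<in> so" for Z
      by (simp add: P_def so_iff transpose_linear_simps scaleR_diff_right)
    show "P Z = Z" if "Z \<in> so" for Z
    proof -
      have "P Z = (1 / 2) *\<^sub>R (Z + Z)" using that by (simp add: P_def so_iff)
      then show ?thesis by (simp only: scaleR_half_double)
    qed
    show "P Z \<bullet> W = Z \<bullet> P W" for Z W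
      using inner_transpose[of Z "transpose W"]
      by (simp add: P_def inner_diff_left inner_diff_right)
  qed
  also have "\<dots> = (1 / 2) * ((\<Sum>i\<in>UNIV. \<Sum>j\<in>UNIV. L (munit i j) $ i $ j)
      - (\<Sum>i\<in>UNIV. \<Sum>j\<in>UNIV. L (munit j i) $ i $ j))"
  proof -
    have "L (P (munit i j)) $ i $ j = (1 / 2) * (L (munit i j) $ i $ j - L (munit j i) $ i $ j)" for i j
      by (simp add: P_def transpose_munit linear_cmul[OF linL] linear_diff[OF linL])
    then show ?thesis by (simp only: sum_distrib_left[symmetric] sum_subtractf)
  qed
  also have "(\<Sum>i\<in>UNIV. \<Sum>j\<in>UNIV. L (munit i j) $ i $ j) = - 2 * real CARD('n) * (X \<bullet> Y)"
  proof -
    have "trace (mat 1 :: 'n sqmat) = real CARD('n)" by (simp add: trace_def mat_def)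
    then show ?thesis
      unfolding L vector_add_component vector_minus_component sum.distrib sum_subtractf sum_diag_sandwich
      using assms by (simp add: trace_mult_skew trace_skew inner_commute)
  qed
  also have "(\<Sum>i\<in>UNIV. \<Sum>j\<in>UNIV. L (munit j i) $ i $ j) = - 4 * (X \<bullet> Y)"
    unfolding L vector_add_component vector_minus_component sum.distrib sum_subtractf sum_diag_sandwich
    using assms by (simp add: trace_mult_skew inner_mat_1 inner_commute)
  finally show ?thesis by (simp add: left_diff_distrib)
qed

lemma g0_so:
  fixes X Y :: "('n::finite) sqmat"
  assumes "X \<in> so" "Y \<in> so"
  shows "g0 X Y = (real CARD('n) - 2) * (X \<bullet> Y)"
  using assms by (simp add: g0_def killing_form_so left_diff_distrib)

section \<open>The homogeneous space\<close>

definition skw :: "'n \<Rightarrow> 'n \<Rightarrow> ('n::finite) sqmat" where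
  "skw i j = munit i j - munit j i"

lemma skw_nth: "skw i j $ k $ l = (if k = i \<and> l = j then 1 else 0) - (if k = j \<and> l = i then 1 else 0)"
  by (simp add: skw_def munit_nth)

lemma skw_in_so: "skw i j \<in> so"
  by (simp add: skw_def so_iff transpose_linear_simps transpose_munit)

lemma block_skw: "block (cls i) (cls j) (skw i j) = skw i j"
proof -
  have "block (cls i) (cls j) (skw i j) $ k $ l = skw i j $ k $ l" for k l
    by (cases "skw i j $ k $ l = 0") (auto simp: block_nth skw_nth split: if_splits)
  then show ?thesis by (simp add: vec_eq_iff)
qed

lemma skw_nonzero:
  assumes "i \<noteq> j" shows "skw i j \<noteq> 0"
proof -
  have "skw i j $ i $ j = 1" using assms by (simp add: skw_nth)
  then show ?thesis by auto
qed

text \<open>With E_ij the matrix units, [E_ij - E_ji, E_jk - E_kj] = E_ik - E_ki. One entry is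
  enough to see that the bracket is nonzero.\<close>

lemma commutator_skw_nth:
  assumes "i \<noteq> j" "j \<noteq> k" "i \<noteq> k" shows "commutator (skw i j) (skw j k) $ i $ k = 1"
proof -
  have "skw i j $ i $ p * skw j k $ p $ k = (if p = j then 1 else 0)" for p
    using assms by (simp add: skw_nth)
  moreover have "(\<Sum>p\<in>UNIV. skw j k $ i $ p * skw i j $ p $ k) = 0"
    by (rule sum.neutral) (use assms in \<open>simp add: skw_nth\<close>)
  ultimately show ?thesis by (simp add: commutator_def matrix_mult_nth)
qed

context
  assumes card4: "4 \<le> CARD('n::finite)"
begin

declare coord_distinct [OF card4, unfolded One_nat_def, simp] cls_simps [OF card4, unfolded One_nat_def, simp]

section \<open>The isotropy group as a part of the centralizer of \<open>B\<close>\<close>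

lemma phi_fixed_iff: "phi A = A \<longleftrightarrow> A ** B = B ** A" for A :: "'n sqmat"
proof -
  have "phi A = A \<longleftrightarrow> B ** A ** transpose B ** B = A ** B"
    unfolding phi_eq[OF card4]
    by (metis B_orth(2)[OF card4] matrix_mul_assoc matrix_mul_rid)
  then show ?thesis
    by (metis B_orth(1)[OF card4] matrix_mul_assoc matrix_mul_rid)
qed

text \<open>Entries joining the class \<open>Two\<close> to another class are negated by \<phi>^2,
  and entries joining \<open>One\<close> to \<open>Rest\<close> by \<phi>; a fixed matrix has zeros
  there.\<close>

lemma phi_fixed_block_diag:
  fixes A :: "'n sqmat"
  assumes "phi A = A" shows "block_diag A"
proof -
  have "A $ i $ j = 0" if "cls i \<noteq> cls j" for i j
  proof (cases "cls i = Two \<or> cls j = Two")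
    case True
    then have "phi (phi A) $ i $ j = - A $ i $ j"
      using that by (auto simp: phi_phi_nth[OF card4])
    then show ?thesis using assms by simp
  next
    case False
    then have "sig i = i" "sig j = j" "eps i * eps j = -1"
      using that by (auto simp: cls_def sig_def eps_def split: if_splits)
    then have "phi A $ i $ j = - A $ i $ j" by (simp add: phi_nth[OF card4])
    then show ?thesis using assms by simp
  qed
  then show ?thesis by (simp add: block_diag_def)
qed

lemma block_diag_row_One:
  fixes A :: "'n sqmat"
  assumes "block_diag A" shows "(A ** C) $ coord 1 $ j = A $ coord 1 $ coord 1 * C $ coord 1 $ j"
proof -
  define v where "v = A $ coord 1 $ coord 1 * C $ coord 1 $ j"
  have "A $ coord 1 $ k * C $ k $ j = (if k = coord 1 then v else 0)" for k
  proof (cases "k = coord 1")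
    case False
    then have "cls (coord 1 :: 'n) \<noteq> cls k"
      unfolding cls_simps(1)[OF card4] by (metis cls_iff(1)[OF card4])
    then have "A $ coord 1 $ k = 0" using assms unfolding block_diag_def by blast
    then show ?thesis by (simp only: False if_False mult_zero_left)
  qed (simp add: v_def)
  then have "(A ** C) $ coord 1 $ j = v" by (simp add: matrix_mult_nth)
  then show ?thesis by (simp only: v_def)
qed

lemma block_diag_row_Two:
  fixes A :: "'n sqmat"
  assumes "block_diag A" "cls i = Two"
  shows "(A ** C) $ i $ j = A $ i $ coord 2 * C $ coord 2 $ j + A $ i $ coord 3 * C $ coord 3 $ j"
proof -
  define v w where "v = A $ i $ coord 2 * C $ coord 2 $ j" and "w = A $ i $ coord 3 * C $ coord 3 $ j"
  have "A $ i $ k * C $ k $ j = (if k = coord 2 then v else 0) + (if k = coord 3 then w else 0)" for k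
  proof (cases "cls k = Two")
    case True
    then have "k = coord 2 \<or> k = coord 3" by (simp only: cls_iff(2)[OF card4])
    then show ?thesis using coord_distinct(5,6)[OF card4] by (auto simp: v_def w_def)
  next
    case False
    then have "cls i \<noteq> cls k" using assms(2) by auto
    then have "A $ i $ k = 0" using assms(1) unfolding block_diag_def by blast
    moreover have "k \<noteq> coord 2" "k \<noteq> coord 3"
      using False unfolding cls_iff(2)[OF card4] by blast+
    ultimately show ?thesis by simp
  qed
  then have "(A ** C) $ i $ j = v + w" by (simp add: matrix_mult_nth sum.distrib)
  then show ?thesis by (simp only: v_def w_def)
qed

lemma sig_eps_coord:
  "sig (coord 1) = (coord 1 :: 'n)" "sig (coord 2) = (coord 3 :: 'n)" "sig (coord 3) = (coord 2 :: 'n)"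
  "eps (coord 1 :: 'n) = 1" "eps (coord 2 :: 'n) = 1" "eps (coord 3 :: 'n) = - 1"
  using coord_distinct[OF card4] by (simp_all add: sig_def eps_def)

lemma sig_eps_Rest:
  fixes i :: 'n
  assumes "cls i = Rest" shows "sig i = i" "eps i = - 1"
  using assms unfolding cls_iff(3)[OF card4] tail_iff[OF card4] by (simp_all add: sig_def eps_def)

lemma H_support_iff:
  "((i = coord 1 \<and> j = coord 1) \<or> (i \<in> {coord 2, coord 3} \<and> j \<in> {coord 2, coord 3}) \<or>
    (i \<in> tail_coords \<and> j \<in> tail_coords)) \<longleftrightarrow> cls i = cls j" for i j :: 'n
  unfolding cls_iff[OF card4, symmetric] insert_iff empty_iff simp_thms
  by (cases "cls i"; cases "cls j") simp_all

text \<open>An orthogonal 2 x 2 block has determinant 1 exactly if it commutes with the rotation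
  block of \<open>B\<close>; the remaining blocks commute with those of \<open>B\<close> in any
  case.\<close>

lemma H_eq: "H = {A :: 'n sqmat. A \<in> SO \<and> phi A = A \<and> A $ coord 1 $ coord 1 = 1}" (is "_ = ?R")
proof (intro set_eqI iffI)
  fix A :: "'n sqmat"
  let ?a = "A $ coord 2 $ coord 2" and ?b = "A $ coord 2 $ coord 3"
  let ?c = "A $ coord 3 $ coord 2" and ?d = "A $ coord 3 $ coord 3"
  have orth: "?a * ?a + ?b * ?b = 1" "?c * ?c + ?d * ?d = 1" if "A \<in> SO" "block_diag A"
    using block_diag_row_Two[OF that(2) cls_simps(2)[OF card4], of "transpose A" "coord 2"]
      block_diag_row_Two[OF that(2) cls_simps(3)[OF card4], of "transpose A" "coord 3"]
    by (simp_all add: SO_orth(2)[OF that(1)] mat_def transpose_nth)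
  {
    assume "A \<in> H"
    then have A: "A \<in> SO" "block_diag A" "A $ coord 1 $ coord 1 = 1" "?a * ?d - ?b * ?c = 1"
      unfolding H_def H_support_iff block_diag_def mem_Collect_eq by (blast+)
    \<comment> \<open>The left side expands to (a^2 + b^2) + (c^2 + d^2) - 2 (ad - bc) = 1 + 1 -
      2.\<close>
    have "(?a - ?d)\<^sup>2 + (?b + ?c)\<^sup>2 = 0"
      using orth[OF A(1,2)] A(4) by (simp add: power2_eq_square algebra_simps)
    then have ad: "?a = ?d" and bc: "?b = - ?c"
      by (simp_all add: sum_power2_eq_zero_iff)
    have "phi A $ i $ j = A $ i $ j" for i j
    proof (cases "cls i = cls j")
      case False
      then show ?thesis using A(2)
        by (simp add: phi_nth[OF card4] block_diag_def cls_sig[OF card4])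
    next
      case True
      show ?thesis
      proof (cases "cls i")
        case One
        then have "i = coord 1" "j = coord 1"
          using True by (simp_all only: cls_iff[OF card4, symmetric])
        then show ?thesis by (simp only: phi_nth[OF card4] sig_eps_coord mult_1_left)
      next
        case Two
        then have "i = coord 2 \<or> i = coord 3" "j = coord 2 \<or> j = coord 3"
          using True by (simp_all only: cls_iff[OF card4, symmetric])
        then show ?thesis using ad bc
          by (elim disjE) (simp_all add: phi_nth[OF card4] sig_eps_coord)
      next
        case Rest
        then show ?thesis using True sig_eps_Rest[of i] sig_eps_Rest[of j]
          by (simp add: phi_nth[OF card4])
      qed
    qed
    then show "A \<in> ?R" using A by (simp add: vec_eq_iff)
  }
  {
    assume R: "A \<in> ?R"
    then have bd: "block_diag A" using phi_fixed_block_diag by blast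
    \<comment> \<open>Comparing entries of \<open>phi A = A\<close> gives the shape of a rotation
      block; its determinant is then a^2 + b^2, the squared norm of a row.\<close>
    have "?a = ?d" "?b = - ?c"
      using R phi_nth[OF card4, of A "coord 2" "coord 2"] phi_nth[OF card4, of A "coord 2" "coord 3"]
        coord_distinct[OF card4]
      by (simp_all add: sig_def eps_def)
    then have "?a * ?d - ?b * ?c = 1"
      using orth(1)[OF _ bd] R by simp
    then show "A \<in> H"
      using R bd unfolding H_def H_support_iff block_diag_def mem_Collect_eq by blast
  }
qed

lemma H_D: "h \<in> H \<Longrightarrow> h \<in> SO" "h \<in> H \<Longrightarrow> phi h = h" for h :: "'n sqmat"
  by (auto simp: H_eq)

lemma H_transpose: "h \<in> H \<Longrightarrow> transpose h \<in> H" for h :: "'n sqmat"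
  by (auto simp: H_eq SO_transpose phi_transpose[OF card4] transpose_nth)

lemma SO_inv: "a \<in> SO \<Longrightarrow> matrix_inv a = transpose a" for a :: "'n sqmat"
  by (rule matrix_inv_orthogonal) (rule SO_orth)

lemma phi_SO: "a \<in> SO \<Longrightarrow> phi a \<in> SO" for a :: "'n sqmat"
proof -
  assume a: "a \<in> SO"
  have "det (B :: 'n sqmat) * det (transpose B :: 'n sqmat) = 1"
    by (simp only: B_orth[OF card4] det_I flip: det_mul)
  then have "det (phi a) = 1" using a
    by (simp add: phi_eq[OF card4] det_mul SO_iff)
  moreover have "transpose (phi a) ** phi a = mat 1"
    using SO_orth(1)[OF a]
    by (simp add: phi_eq[OF card4, of "mat 1"] B_orth[OF card4]
        flip: phi_transpose[OF card4] phi_mult[OF card4])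
  ultimately show "phi a \<in> SO" by (simp add: SO_iff)
qed

lemma skw_coord:
  "p1 (skw (coord 1) (coord 2)) = skw (coord 1) (coord 2 :: 'n)"
  "p1 (skw (coord 1) (coord 3)) = skw (coord 1) (coord 3 :: 'n)"
  "p2 (skw (coord 3) (coord 4)) = skw (coord 3) (coord 4 :: 'n)"
  "p3 (skw (coord 1) (coord 4)) = skw (coord 1) (coord 4 :: 'n)"
  using block_skw[of "coord 1" "coord 2 :: 'n"] block_skw[of "coord 1" "coord 3 :: 'n"]
    block_skw[of "coord 3" "coord 4 :: 'n"] block_skw[of "coord 1" "coord 4 :: 'n"]
  by (simp_all only: cls_simps[OF card4] cls_coord4[OF card4])

text \<open>If \<phi>^2 fixed all of SO(n), differentiating along exp(tX) would give \<phi>^2 X = X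
  on \<open>so\<close>, whereas \<phi>^2 = -1 on \<open>\<mm>1\<close>.\<close>

lemma ex_phi_phi_moves: "\<exists>a\<in>SO. phi (phi a) \<noteq> (a :: 'n sqmat)"
proof (rule ccontr)
  assume "\<not> ?thesis"
  then have fixed: "phi (phi a) = a" if "a \<in> SO" for a :: "'n sqmat" using that by blast
  define X where "X = skw (coord 1) (coord 2 :: 'n)"
  have lin: "bounded_linear (\<lambda>x. phi (phi x) :: 'n sqmat)"
    by (simp add: linear_phi[OF card4] linear_compose[of phi phi, unfolded o_def]
        flip: linear_conv_bounded_linear)
  have d: "((\<lambda>t. mexp (t *\<^sub>R X)) has_vector_derivative X) (at 0)"
    using mexp_derivative_0[of "mat 1" X] by simp
  have "((\<lambda>t. phi (phi (mexp (t *\<^sub>R X)))) has_vector_derivative phi (phi X)) (at 0)"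
    by (rule bounded_linear.has_vector_derivative[OF lin d])
  then have "((\<lambda>t. mexp (t *\<^sub>R X)) has_vector_derivative phi (phi X)) (at 0)"
    by (simp add: fixed mexp_in_SO X_def skw_in_so)
  then have "phi (phi X) = X" using d vector_derivative_unique_at by blast
  moreover have "phi (phi X) = - X"
    using phi_phi_p1[OF card4, of X] by (simp only: X_def skw_coord)
  then have "phi (phi X) $ coord 1 $ coord 2 = - 1" by (simp add: X_def skw_nth)
  ultimately show False by (simp add: X_def skw_nth)
qed

lemma Phi_space: "homogeneous_Phi_space (H :: 'n sqmat set) Phi 4"
proof -
  note PP = phi_eq_Phi[OF card4, symmetric]
  have pow: "(phi ^^ 4) a = a" for a :: "'n sqmat"
    by (simp add: eval_nat_numeral phi_pow4[OF card4])
  have "smooth_on_SO (phi :: 'n sqmat \<Rightarrow> _)"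
    by (rule smooth_on_SO_linear[OF linear_phi[OF card4]])
  moreover have "bij_betw (phi :: 'n sqmat \<Rightarrow> _) SO SO"
    by (rule bij_betw_byWitness[where f' = "\<lambda>a. phi (phi (phi a))"])
      (auto simp: phi_pow4[OF card4] phi_SO)
  moreover have "\<exists>a\<in>SO. (phi ^^ j) a \<noteq> (a :: 'n sqmat)" if j: "0 < j" "j < 4" for j
  proof (rule ccontr)
    assume "\<not> ?thesis"
    then have fixed: "(phi ^^ j) a = a" if "a \<in> SO" for a :: "'n sqmat" using that by blast
    \<comment> \<open>For j = 3 the relation \<phi>^4 = 1 gives \<phi> a = a, so all three exponents
      imply that \<phi>^2 is the identity on \<open>SO\<close>.\<close>
    have "j = 1 \<or> j = 2 \<or> j = 3" using j by auto
    then have "phi (phi a) = a" if "a \<in> SO" for a :: "'n sqmat"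
      using fixed[OF that] phi_pow4[OF card4, of a] by (auto simp: eval_nat_numeral)
    then show False using ex_phi_phi_moves by blast
  qed
  moreover have "mat 1 \<in> (H :: 'n sqmat set)"
  proof -
    have "(mat 1 :: 'n sqmat) $ coord 1 $ coord 1 = 1" by (simp add: mat_def)
    then show ?thesis by (simp add: H_eq SO_one phi_eq[OF card4] B_orth[OF card4])
  qed
  moreover have "a ** b \<in> H" if "a \<in> H" "b \<in> H" for a b :: "'n sqmat"
    using that block_diag_row_One[OF phi_fixed_block_diag[OF H_D(2)[OF that(1)]], of b "coord 1"]
    by (simp add: H_eq SO_mult phi_mult[OF card4])
  moreover have "matrix_inv a \<in> H" if "a \<in> H" for a :: "'n sqmat"
    using that by (simp add: SO_inv H_D H_transpose)
  moreover have "connected_component_set {a \<in> SO. phi a = a} (mat 1) \<subseteq> (H :: 'n sqmat set)"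
  proof
    let ?S = "{a \<in> SO. phi a = a} :: 'n sqmat set"
    let ?C = "connected_component_set ?S (mat 1)"
    \<comment> \<open>For a fixed element the first row has the (1, 1)-entry as its only nonzero
      entry, so by orthogonality that entry is 1 or -1. By continuity it is constant on the identity
      component.\<close>
    let ?f = "\<lambda>a :: 'n sqmat. a $ coord 1 $ coord 1"
    fix a assume a: "a \<in> ?C"
    have sub: "?C \<subseteq> ?S" by (rule connected_component_subset)
    have one: "mat 1 \<in> ?C"
      using \<open>mat 1 \<in> H\<close> H_D by (simp add: connected_component_refl_eq)
    have "continuous_on ?C ?f" by (intro continuous_intros)
    then have "connected (?f ` ?C)"
      by (rule connected_continuous_image) (rule connected_connected_component)
    moreover have "?f ` ?C \<subseteq> {-1, 1}"
    proof (rule image_subsetI)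
      fix c assume "c \<in> ?C"
      then have c: "c \<in> SO" "phi c = c" using sub by auto
      have "?f c * ?f c = (c ** transpose c) $ coord 1 $ coord 1"
        unfolding block_diag_row_One[OF phi_fixed_block_diag[OF c(2)]] by (simp add: transpose_nth)
      also have "\<dots> = 1" using SO_orth(2)[OF c(1)] by (simp add: mat_def)
      finally show "?f c \<in> {-1, 1}" by (auto simp: square_eq_1_iff)
    qed
    then have "finite (?f ` ?C)" by (rule finite_subset) simp
    ultimately have "?f ` ?C = {} \<or> (\<exists>d. ?f ` ?C = {d})"
      using connected_finite_iff_sing[of "?f ` ?C"] by (simp only:)
    then obtain d where d: "?f ` ?C = {d}" using a by blast
    have "?f a = ?f (mat 1)"
      using imageI[OF a, of ?f] imageI[OF one, of ?f] unfolding d by (simp only: singleton_iff)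
    then have "?f a = 1" by (simp add: mat_def)
    then show "a \<in> H" using a sub unfolding H_eq by blast
  qed
  moreover have "H \<subseteq> {a \<in> SO. phi a = (a :: 'n sqmat)}"
    by (auto simp: H_eq)
  ultimately show ?thesis
    unfolding homogeneous_Phi_space_def PP by (simp add: phi_mult[OF card4] pow)
qed

section \<open>Canonical f-structures\<close>

text \<open>Where \<phi>^2 = -1, \<phi> behaves like the imaginary unit. The order of the
  quantifiers matters: \<alpha> and \<beta> do not depend on \<open>X\<close>.\<close>

lemma phi_pow_rotation:
  "\<exists>\<alpha> \<beta>. \<forall>X :: 'n sqmat. phi (phi X) = - X \<longrightarrow> (phi ^^ k) X = \<alpha> *\<^sub>R X + \<beta> *\<^sub>R phi X"
proof (induction k)
  case 0
  show ?case by (rule exI[of _ 1], rule exI[of _ 0]) simp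
next
  case (Suc k)
  then obtain \<alpha> \<beta> where ab: "\<And>X :: 'n sqmat. phi (phi X) = - X \<Longrightarrow> (phi ^^ k) X = \<alpha> *\<^sub>R X + \<beta> *\<^sub>R phi X"
    by blast
  have "(phi ^^ Suc k) X = (- \<beta>) *\<^sub>R X + \<alpha> *\<^sub>R phi X" if "phi (phi X) = - X" for X :: "'n sqmat"
    using ab[OF that] that by (simp add: phi_linear_simps[OF card4])
  then show ?case by blast
qed

lemma phi_polynomial_rotation:
  "\<exists>\<alpha> \<beta>. \<forall>X :: 'n sqmat. phi (phi X) = - X \<longrightarrow>
    (\<Sum>k\<le>N. c k *\<^sub>R (phi ^^ k) X) = \<alpha> *\<^sub>R X + \<beta> *\<^sub>R phi X"
proof -
  obtain a b where ab: "\<And>k (X :: 'n sqmat). phi (phi X) = - X \<Longrightarrow> (phi ^^ k) X = a k *\<^sub>R X + b k *\<^sub>R phi X"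
    using phi_pow_rotation by metis
  have "(\<Sum>k\<le>N. c k *\<^sub>R (phi ^^ k) X) = (\<Sum>k\<le>N. c k * a k) *\<^sub>R X + (\<Sum>k\<le>N. c k * b k) *\<^sub>R phi X"
    if "phi (phi X) = - X" for X :: "'n sqmat"
    by (simp add: ab[OF that] scaleR_add_right sum.distrib scaleR_sum_left)
  then show ?thesis by blast
qed

lemma phi_polynomial_reflection:
  fixes X :: "'n sqmat"
  assumes "phi X = - X"
  shows "(\<Sum>k\<le>N. c k *\<^sub>R (phi ^^ k) X) = (\<Sum>k\<le>N. c k * (- 1) ^ k) *\<^sub>R X"
proof -
  have "(phi ^^ k) X = (- 1) ^ k *\<^sub>R X" for k
    by (induction k) (simp_all add: phi_linear_simps[OF card4] assms)
  then show ?thesis by (simp add: scaleR_sum_left)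
qed

lemma mm_decomp: "X \<in> \<mm> \<Longrightarrow> X = p1 X + p2 X + p3 X" for X :: "'n sqmat"
  unfolding mm_iff[OF card4] pm_def by simp

lemma block_in_mm:
  "X \<in> so \<Longrightarrow> p1 X \<in> \<mm>" "X \<in> so \<Longrightarrow> p2 X \<in> \<mm>" "X \<in> so \<Longrightarrow> p3 X \<in> \<mm>" for X :: "'n sqmat"
  by (simp_all add: mm_iff[OF card4] block_in_so pm_p)

lemma phi_in_mm: "X \<in> \<mm> \<Longrightarrow> phi X \<in> \<mm>" for X :: "'n sqmat"
  unfolding mm_iff[OF card4] by (metis pm_def phi_block[OF card4] phi_in_so[OF card4] phi_linear_simps(1)[OF card4])

lemma subspace_mm: "subspace (\<mm> :: 'n sqmat set)"
  by (simp add: subspace_def mm_iff[OF card4] subspace_0[OF subspace_so] subspace_add[OF subspace_so]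
      subspace_scale[OF subspace_so] linear_add[OF linear_pm] linear_cmul[OF linear_pm]
      linear_0[OF linear_pm])

lemma so_subset: "X \<in> \<mm> \<Longrightarrow> X \<in> so" for X :: "'n sqmat"
  by (simp add: mm_iff[OF card4])

lemma Ad_eq: "h \<in> SO \<Longrightarrow> Ad h X = h ** X ** transpose h" for h X :: "'n sqmat"
  by (simp add: Ad_def SO_inv)

lemma phi_Ad: "h \<in> H \<Longrightarrow> phi (Ad h X) = Ad h (phi X)" for h X :: "'n sqmat"
  by (simp add: Ad_eq H_D phi_mult[OF card4] phi_transpose[OF card4])

lemma f0_Ad: "h \<in> H \<Longrightarrow> f0 (Ad h X) = Ad h (f0 X)" for h X :: "'n sqmat"
  by (simp add: f0_eq[OF card4] phi_Ad) (simp add: Ad_eq H_D mm_simps scaleR_diff_right)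

lemma f0_f_structure: "f_structure (f0 :: 'n sqmat \<Rightarrow> _)"
  unfolding f_structure_def invariant_endomorphism_def
  by (simp add: f0_in_mm[OF card4] f0_linear_simps[OF card4] f0_Ad f0_cube[OF card4])

lemma f0_canonical: "canonical (f0 :: 'n sqmat \<Rightarrow> _)"
  unfolding canonical_def
proof (intro exI ballI)
  fix X :: "'n sqmat"
  show "f0 X = (\<Sum>k\<le>3. (if k = 1 then 1 / 2 else if k = 3 then - (1 / 2) else 0 :: real) *\<^sub>R (phi ^^ k) X)"
    by (simp add: f0_eq[OF card4] eval_nat_numeral scaleR_diff_right)
qed

text \<open>The hypotheses are the real and imaginary parts of z^3 + z = 0 for z = \<alpha> + i
  \<beta>, so z is 0, i or -i.\<close>

lemma rotation_cube_roots:
  fixes \<alpha> \<beta> :: real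
  assumes "\<alpha> ^ 3 - 3 * \<alpha> * \<beta>\<^sup>2 + \<alpha> = 0" "3 * \<alpha>\<^sup>2 * \<beta> - \<beta> ^ 3 + \<beta> = 0"
  shows "\<alpha> = 0 \<and> (\<beta> = 0 \<or> \<beta> = 1 \<or> \<beta> = - 1)"
proof -
  have 1: "\<alpha> * (\<alpha>\<^sup>2 - 3 * \<beta>\<^sup>2 + 1) = 0" "\<beta> * (3 * \<alpha>\<^sup>2 - \<beta>\<^sup>2 + 1) = 0"
    using assms by (simp_all add: algebra_simps power2_eq_square power3_eq_cube)
  have pos: "\<alpha>\<^sup>2 \<ge> 0" by simp
  have "\<alpha> = 0"
  proof (rule ccontr)
    assume "\<alpha> \<noteq> 0"
    then have "\<alpha>\<^sup>2 - 3 * \<beta>\<^sup>2 + 1 = 0" using 1 by simp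
    moreover have "\<beta> = 0 \<or> 3 * \<alpha>\<^sup>2 - \<beta>\<^sup>2 + 1 = 0" using 1 by simp
    ultimately show False
    proof (elim disjE)
      assume "\<alpha>\<^sup>2 - 3 * \<beta>\<^sup>2 + 1 = 0" "\<beta> = 0"
      then have "\<alpha>\<^sup>2 + 1 = 0" by simp
      with pos show False by linarith
    qed (use pos in linarith)
  qed
  with 1 have "\<beta> = 0 \<or> \<beta>\<^sup>2 = 1" by auto
  then show ?thesis using \<open>\<alpha> = 0\<close> by (auto simp: power2_eq_1_iff)
qed

text \<open>A canonical f' acts as z = \<alpha> + i \<beta> on the first two summands, with \<phi>
  as i, and as a real scalar \<gamma> on the third. The f-structure equation, tested on one vector
  \<open>x0\<close> and one vector \<open>z0\<close>, leaves z in {0, i, -i} and \<gamma> = 0, so f'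
  is \<beta> times \<open>f0\<close>.\<close>

lemma f0_only: "only_canonical_f_structure (f0 :: 'n sqmat \<Rightarrow> _)"
proof -
  define x0 where "x0 = skw (coord 1) (coord 2 :: 'n)"
  have x0: "x0 \<in> \<mm>" "p1 x0 = x0" "x0 \<noteq> 0"
    using block_in_mm(1)[OF skw_in_so] skw_coord(1) skw_nonzero[OF coord_distinct(1)[OF card4]]
    by (metis x0_def)+
  have ppx: "phi (phi x0) = - x0" using phi_phi_p1[OF card4, of x0] x0 by simp
  have fx: "f0 x0 = phi x0" using f0_p1[OF card4, of x0] x0 by simp
  have "phi x0 \<noteq> 0" using ppx x0(3) phi_linear_simps(5)[OF card4] by auto
  \<comment> \<open>Orthogonality of \<open>x0\<close> and \<open>phi x0\<close>: the inner product
    equals that of \<open>phi x0\<close> and \<open>phi (phi x0) = - x0\<close>, hence its own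
    negative.\<close>
  have indep: "a = 0 \<and> b = 0" if "a *\<^sub>R x0 + b *\<^sub>R phi x0 = 0" for a b
  proof -
    have "x0 \<bullet> phi x0 = phi x0 \<bullet> phi (phi x0)" by (simp add: inner_phi[OF card4])
    then have o: "x0 \<bullet> phi x0 = 0" "phi x0 \<bullet> x0 = 0" by (simp_all add: ppx inner_commute)
    have "(a *\<^sub>R x0 + b *\<^sub>R phi x0) \<bullet> x0 = a * (x0 \<bullet> x0)"
      "(a *\<^sub>R x0 + b *\<^sub>R phi x0) \<bullet> phi x0 = b * (phi x0 \<bullet> phi x0)"
      by (simp_all add: inner_add_left o)
    then show ?thesis using that x0(3) \<open>phi x0 \<noteq> 0\<close> by simp
  qed
  define z0 where "z0 = skw (coord 1) (coord 4 :: 'n)"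
  have "cls (coord 1 :: 'n) \<noteq> cls (coord 4 :: 'n)" by (simp add: cls_coord4[OF card4])
  then have "coord 1 \<noteq> (coord 4 :: 'n)" by metis
  then have z0: "z0 \<in> \<mm>" "p3 z0 = z0" "z0 \<noteq> 0"
    using block_in_mm(3)[OF skw_in_so] skw_coord(4) skw_nonzero by (metis z0_def)+
  have pz: "phi z0 = - z0" using phi_p3[OF card4, of z0] z0 by simp
  have "(\<forall>X\<in>\<mm>. f' X = f0 X) \<or> (\<forall>X\<in>\<mm>. f' X = - f0 X)"
    if f': "canonical f'" "f_structure f'" "\<exists>X\<in>\<mm>. f' X \<noteq> 0" for f' :: "'n sqmat \<Rightarrow> 'n sqmat"
  proof -
    obtain N c where c: "\<And>X. X \<in> \<mm> \<Longrightarrow> f' X = (\<Sum>k\<le>N. c k *\<^sub>R (phi ^^ k) X)"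
      using f'(1) unfolding canonical_def by blast
    obtain \<alpha> \<beta> where "\<forall>X :: 'n sqmat. phi (phi X) = - X \<longrightarrow>
        (\<Sum>k\<le>N. c k *\<^sub>R (phi ^^ k) X) = \<alpha> *\<^sub>R X + \<beta> *\<^sub>R phi X"
      using phi_polynomial_rotation by blast
    then have rot: "f' X = \<alpha> *\<^sub>R X + \<beta> *\<^sub>R phi X" if "X \<in> \<mm>" "phi (phi X) = - X" for X
      using c that by simp
    define \<gamma> where "\<gamma> = (\<Sum>k\<le>N. c k * (- 1) ^ k)"
    have refl: "f' X = \<gamma> *\<^sub>R X" if "X \<in> \<mm>" "phi X = - X" for X
      using c phi_polynomial_reflection that by (simp add: \<gamma>_def)
    have cube: "f' (f' (f' X)) + f' X = 0" if "X \<in> \<mm>" for X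
      using f'(2) that by (simp add: f_structure_def)
    \<comment> \<open>Complex multiplication by \<alpha> + i \<beta> in the basis \<open>x0\<close>,
      \<open>phi x0\<close>.\<close>
    have rot2: "f' (a *\<^sub>R x0 + b *\<^sub>R phi x0) = (\<alpha> * a - \<beta> * b) *\<^sub>R x0 + (\<alpha> * b + \<beta> * a) *\<^sub>R phi x0" for a b
    proof -
      have "a *\<^sub>R x0 + b *\<^sub>R phi x0 \<in> \<mm>"
        using x0 phi_in_mm by (intro subspace_add subspace_scale subspace_mm) auto
      moreover have "phi (phi (a *\<^sub>R x0 + b *\<^sub>R phi x0)) = - (a *\<^sub>R x0 + b *\<^sub>R phi x0)"
        by (simp add: phi_linear_simps[OF card4] ppx)
      ultimately show ?thesis
        by (simp add: rot phi_linear_simps[OF card4] ppx scaleR_add_right scaleR_add_left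
            scaleR_diff_left scaleR_diff_right)
    qed
    have "(\<alpha> ^ 3 - 3 * \<alpha> * \<beta>\<^sup>2 + \<alpha>) *\<^sub>R x0 + (3 * \<alpha>\<^sup>2 * \<beta> - \<beta> ^ 3 + \<beta>) *\<^sub>R phi x0
        = f' (f' (f' (1 *\<^sub>R x0 + 0 *\<^sub>R phi x0))) + f' (1 *\<^sub>R x0 + 0 *\<^sub>R phi x0)"
    proof -
      have e: "(a *\<^sub>R x0 + b *\<^sub>R phi x0) + (a' *\<^sub>R x0 + b' *\<^sub>R phi x0) = (a + a') *\<^sub>R x0 + (b + b') *\<^sub>R phi x0"
        for a b a' b' by (simp add: scaleR_add_left)
      show ?thesis
        unfolding rot2 e by (simp add: power2_eq_square power3_eq_cube algebra_simps del: scaleR_scaleR)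
    qed
    also have "\<dots> = 0" using cube[OF x0(1)] by simp
    finally have "\<alpha> = 0 \<and> (\<beta> = 0 \<or> \<beta> = 1 \<or> \<beta> = - 1)"
      using indep rotation_cube_roots by blast
    then have ab: "\<alpha> = 0" "\<beta> = 0 \<or> \<beta> = 1 \<or> \<beta> = - 1" by blast+
    have "f' z0 = \<gamma> *\<^sub>R z0" using refl z0 pz by blast
    moreover have g2: "f' (g *\<^sub>R z0) = (\<gamma> * g) *\<^sub>R z0" for g
      using refl[of "g *\<^sub>R z0"] z0 subspace_scale[OF subspace_mm] by (simp add: phi_linear_simps[OF card4] pz)
    ultimately have "(\<gamma> * (\<gamma> * \<gamma>) + \<gamma>) *\<^sub>R z0 = 0"
      using cube[OF z0(1)] by (simp add: scaleR_add_left)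
    then have "\<gamma> * (\<gamma> * \<gamma>) + \<gamma> = 0" using z0(3) unfolding scaleR_eq_0_iff by blast
    then have "\<gamma> * (\<gamma> * \<gamma> + 1) = 0" by (simp only: distrib_left mult_1_right)
    moreover have "\<gamma> * \<gamma> + 1 > 0" by (simp add: add_nonneg_pos)
    ultimately have g: "\<gamma> = 0" by simp
    have f'f: "f' X = \<beta> *\<^sub>R f0 X" if X: "X \<in> \<mm>" for X
    proof -
      have add: "f' (U + V) = f' U + f' V" if "U \<in> \<mm>" "V \<in> \<mm>" for U V
        using f'(2) that by (simp add: f_structure_def invariant_endomorphism_def)
      have m: "p1 X \<in> \<mm>" "p2 X \<in> \<mm>" "p3 X \<in> \<mm>" using block_in_mm[OF so_subset[OF X]] .
      have "f' X = f' (p1 X) + f' (p2 X) + f' (p3 X)"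
        using mm_decomp[OF X] add m subspace_add[OF subspace_mm] by metis
      also have "\<dots> = \<beta> *\<^sub>R phi (p1 X) + \<beta> *\<^sub>R phi (p2 X)"
        using m by (simp add: rot refl ab(1) g phi_phi_p1[OF card4] phi_phi_p2[OF card4] phi_p3[OF card4])
      also have "\<dots> = \<beta> *\<^sub>R f0 (p1 X + p2 X + p3 X)"
        by (simp add: f0_linear_simps[OF card4] f0_p1[OF card4] f0_p2[OF card4] f0_p3[OF card4] scaleR_add_right)
      also have "\<dots> = \<beta> *\<^sub>R f0 X" using mm_decomp[OF X] by (simp only: flip: mm_decomp)
      finally show ?thesis .
    qed
    show ?thesis using ab(2) f'(3) f'f by auto
  qed
  then show ?thesis
    unfolding only_canonical_f_structure_def
    using f0_canonical f0_f_structure x0(1) fx \<open>phi x0 \<noteq> 0\<close> by metis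
qed

end

section \<open>Algebra of the Levi-Civita connection\<close>

text \<open>The invariant metric with characteristic numbers (s, t), up to a positive factor and
  extended bilinearly to all matrices. Projecting one argument suffices because the blocks are
  orthogonal projections.\<close>

definition Qf :: "real \<Rightarrow> real \<Rightarrow> ('n::finite) sqmat \<Rightarrow> 'n sqmat \<Rightarrow> real" where
  "Qf s t x y = p1 x \<bullet> y + s * (p2 x \<bullet> y) + t * (p3 x \<bullet> y)"

text \<open>The coefficient of \<open>[x\<^sub>i, y\<^sub>j]\<close>, an element of \<open>\<mm>\<^sub>k\<close>, is \<open>(1 + (g\<^sub>j - g\<^sub>i) / g\<^sub>k) / 2\<close> with
  \<open>(g\<^sub>1, g\<^sub>2, g\<^sub>3) = (1, s, t)\<close>; this is Koszul's formula for an invariant metric.\<close>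

definition Lam :: "real \<Rightarrow> real \<Rightarrow> ('n::finite) sqmat \<Rightarrow> 'n sqmat \<Rightarrow> 'n sqmat" where
  "Lam s t x y =
     ((1 + (t - s)) / 2) *\<^sub>R commutator (p2 x) (p3 y) + ((1 + (s - t)) / 2) *\<^sub>R commutator (p3 x) (p2 y) +
     ((1 + (t - 1) / s) / 2) *\<^sub>R commutator (p1 x) (p3 y) + ((1 + (1 - t) / s) / 2) *\<^sub>R commutator (p3 x) (p1 y) +
     ((1 + (s - 1) / t) / 2) *\<^sub>R commutator (p1 x) (p2 y) + ((1 + (1 - s) / t) / 2) *\<^sub>R commutator (p2 x) (p1 y)"

lemma Qf_sym: "Qf s t x y = Qf s t y x"
  by (simp add: Qf_def inner_block inner_commute[of x])

lemma Qf_add: "Qf s t (x + x') y = Qf s t x y + Qf s t x' y" "Qf s t x (y + y') = Qf s t x y + Qf s t x y'"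
  and Qf_diff: "Qf s t (x - x') y = Qf s t x y - Qf s t x' y" "Qf s t x (y - y') = Qf s t x y - Qf s t x y'"
  and Qf_scaleR: "Qf s t (c *\<^sub>R x) y = c * Qf s t x y" "Qf s t x (c *\<^sub>R y) = c * Qf s t x y"
  by (simp_all add: Qf_def block_linear_simps inner_add_left inner_add_right inner_diff_left
      inner_diff_right algebra_simps)

lemma bounded_bilinear_Qf: "bounded_bilinear (Qf s t :: ('n::finite) sqmat \<Rightarrow> _)"
  unfolding bilinear_conv_bounded_bilinear[symmetric] bilinear_def
  by (auto intro!: linearI simp: Qf_add Qf_scaleR)

lemma Qf_definite:
  assumes "s > 0" "t > 0" "Qf s t x x = 0" "pm x = x" shows "x = 0"
proof -
  have e: "block k l x \<bullet> x = block k l x \<bullet> block k l x" for k l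
    by (simp add: inner_block[of k l x] block_block inner_commute)
  have "p1 x \<bullet> p1 x + s * (p2 x \<bullet> p2 x) + t * (p3 x \<bullet> p3 x) = 0"
    using assms(3) by (simp only: Qf_def e[symmetric])
  moreover have "s * (p2 x \<bullet> p2 x) \<ge> 0" "t * (p3 x \<bullet> p3 x) \<ge> 0" "p1 x \<bullet> p1 x \<ge> 0"
    using assms(1,2) by simp_all
  ultimately have "p1 x \<bullet> p1 x = 0" "s * (p2 x \<bullet> p2 x) = 0" "t * (p3 x \<bullet> p3 x) = 0"
    by linarith+
  then have "p1 x = 0" "p2 x = 0" "p3 x = 0" using assms(1,2) by simp_all
  then show ?thesis using assms(4) by (simp add: pm_def)
qed

lemma pm_Lam: "pm (Lam s t x y) = Lam s t x y"
  by (simp add: Lam_def linear_add[OF linear_pm] linear_cmul[OF linear_pm] pm_commutator_p)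

lemma Lam_in_so: "x \<in> so \<Longrightarrow> y \<in> so \<Longrightarrow> Lam s t x y \<in> so"
  unfolding Lam_def
  by (intro subspace_add[OF subspace_so] subspace_scale[OF subspace_so] commutator_in_so block_in_so)

lemma Lam_torsion: "Lam s t x y - Lam s t y x = pm (commutator (pm x) (pm y))"
proof -
  \<comment> \<open>The coefficients of a bracket coming from \<open>Lam s t x y\<close> and from
    \<open>Lam s t y x\<close> add up to 1.\<close>
  have h: "((1 + (a - b) / c) / 2) *\<^sub>R z + ((1 + (b - a) / c) / 2) *\<^sub>R z = z" for a b c and z :: "'a sqmat"
  proof -
    have "(1 + q) / 2 + (1 + - q) / 2 = 1" for q :: real by (simp add: field_simps)
    moreover have "(b - a) / c = - ((a - b) / c)" by (simp add: minus_divide_left)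
    ultimately have "(1 + (a - b) / c) / 2 + (1 + (b - a) / c) / 2 = 1" by (simp only:)
    then show ?thesis by (metis scaleR_add_left scaleR_one)
  qed
  let ?A = "commutator (p2 x) (p3 y)" let ?B = "commutator (p3 x) (p2 y)"
  let ?C = "commutator (p1 x) (p3 y)" let ?D = "commutator (p3 x) (p1 y)"
  let ?E = "commutator (p1 x) (p2 y)" let ?F = "commutator (p2 x) (p1 y)"
  have yx: "Lam s t y x =
     - (((1 + (t - s)) / 2) *\<^sub>R ?B + ((1 + (s - t)) / 2) *\<^sub>R ?A +
     ((1 + (t - 1) / s) / 2) *\<^sub>R ?D + ((1 + (1 - t) / s) / 2) *\<^sub>R ?C +
     ((1 + (s - 1) / t) / 2) *\<^sub>R ?F + ((1 + (1 - s) / t) / 2) *\<^sub>R ?E)"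
    unfolding Lam_def
      commutator_swap[of "p2 y" "p3 x"] commutator_swap[of "p3 y" "p2 x"]
      commutator_swap[of "p1 y" "p3 x"] commutator_swap[of "p3 y" "p1 x"]
      commutator_swap[of "p1 y" "p2 x"] commutator_swap[of "p2 y" "p1 x"]
    by (simp only: scaleR_minus_right minus_add_distrib)
  \<comment> \<open>The divisions by 1 bring the first two pairs into the form of
    \<open>h\<close>.\<close>
  have "Lam s t x y - Lam s t y x =
     (((1 + (t - s) / 1) / 2) *\<^sub>R ?A + ((1 + (s - t) / 1) / 2) *\<^sub>R ?A) +
     (((1 + (s - t) / 1) / 2) *\<^sub>R ?B + ((1 + (t - s) / 1) / 2) *\<^sub>R ?B) +
     (((1 + (t - 1) / s) / 2) *\<^sub>R ?C + ((1 + (1 - t) / s) / 2) *\<^sub>R ?C) +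
     (((1 + (1 - t) / s) / 2) *\<^sub>R ?D + ((1 + (t - 1) / s) / 2) *\<^sub>R ?D) +
     (((1 + (s - 1) / t) / 2) *\<^sub>R ?E + ((1 + (1 - s) / t) / 2) *\<^sub>R ?E) +
     (((1 + (1 - s) / t) / 2) *\<^sub>R ?F + ((1 + (s - 1) / t) / 2) *\<^sub>R ?F)"
    unfolding yx unfolding Lam_def by (simp only: diff_minus_eq_add div_by_1 add_ac)
  also have "\<dots> = pm (commutator (pm x) (pm y))"
    unfolding h pm_commutator ..
  finally show ?thesis .
qed

lemma p_Lam:
  "p1 (Lam s t x y) = ((1 + (t - s)) / 2) *\<^sub>R commutator (p2 x) (p3 y)
     + ((1 + (s - t)) / 2) *\<^sub>R commutator (p3 x) (p2 y)" (is ?A)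
  "p2 (Lam s t x y) = ((1 + (t - 1) / s) / 2) *\<^sub>R commutator (p1 x) (p3 y)
     + ((1 + (1 - t) / s) / 2) *\<^sub>R commutator (p3 x) (p1 y)" (is ?B)
  "p3 (Lam s t x y) = ((1 + (s - 1) / t) / 2) *\<^sub>R commutator (p1 x) (p2 y)
     + ((1 + (1 - s) / t) / 2) *\<^sub>R commutator (p2 x) (p1 y)" (is ?C)
proof -
  have z: "p2 (commutator (p2 x) (p3 y)) = 0" "p3 (commutator (p2 x) (p3 y)) = 0"
    "p2 (commutator (p3 x) (p2 y)) = 0" "p3 (commutator (p3 x) (p2 y)) = 0"
    "p1 (commutator (p1 x) (p3 y)) = 0" "p3 (commutator (p1 x) (p3 y)) = 0"
    "p1 (commutator (p3 x) (p1 y)) = 0" "p3 (commutator (p3 x) (p1 y)) = 0"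
    "p1 (commutator (p1 x) (p2 y)) = 0" "p2 (commutator (p1 x) (p2 y)) = 0"
    "p1 (commutator (p2 x) (p1 y)) = 0" "p2 (commutator (p2 x) (p1 y)) = 0"
    using p_p(3,5)[of "commutator (p2 x) (p3 y)"] p_p(3,5)[of "commutator (p3 x) (p2 y)"]
      p_p(1,6)[of "commutator (p1 x) (p3 y)"] p_p(1,6)[of "commutator (p3 x) (p1 y)"]
      p_p(2,4)[of "commutator (p1 x) (p2 y)"] p_p(2,4)[of "commutator (p2 x) (p1 y)"]
    by (simp_all only: p_of_commutator)
  show ?A ?B ?C
    unfolding Lam_def by (simp_all add: block_linear_simps p_of_commutator z)
qed

text \<open>With (g1, g2, g3) = (1, s, t), the coefficient of [x_i, y_j] \<bullet> z_k is (g_k + g_j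
  - g_i) / 2. It is symmetric in j and k, while the triple product is skew in its last two
  arguments.\<close>

lemma Lam_metric:
  assumes "s > 0" "t > 0" "x \<in> so"
  shows "Qf s t (Lam s t x y) z + Qf s t y (Lam s t x z) = 0"
proof -
  define T where "T k l Y Z = commutator (block k l x) Y \<bullet> Z" for k l Y Z
  have T: "T k l Y Z = - T k l Z Y" for k l Y Z
    unfolding T_def using commutator_skew_adjoint[OF block_in_so[OF assms(3)], of k l Y Z]
    by (simp add: inner_commute)
  have Q: "Qf s t (Lam s t x y) z =
     ((1 + (t - s)) / 2) * T Two Rest (p3 y) (p1 z) + ((1 + (s - t)) / 2) * T One Rest (p2 y) (p1 z) +
     ((s + (t - 1)) / 2) * T One Two (p3 y) (p2 z) + ((s + (1 - t)) / 2) * T One Rest (p1 y) (p2 z) +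
     ((t + (s - 1)) / 2) * T One Two (p2 y) (p3 z) + ((t + (1 - s)) / 2) * T Two Rest (p1 y) (p3 z)" for y z
  proof -
    have "Qf s t L z = p1 L \<bullet> p1 z + s * (p2 L \<bullet> p2 z) + t * (p3 L \<bullet> p3 z)" for L
      by (simp add: Qf_def block_block flip: inner_block)
    moreover have "s * ((1 + (t - 1) / s) / 2) = (s + (t - 1)) / 2" "s * ((1 + (1 - t) / s) / 2) = (s + (1 - t)) / 2"
      "t * ((1 + (s - 1) / t) / 2) = (t + (s - 1)) / 2" "t * ((1 + (1 - s) / t) / 2) = (t + (1 - s)) / 2"
      using assms(1,2) by (simp_all add: field_simps)
    ultimately show ?thesis
      by (simp only: p_Lam inner_add_left inner_scaleR_left T_def distrib_left mult.assoc[symmetric] add.assoc)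
  qed
  show ?thesis
    unfolding Qf_sym[of s t y] Q
      T[of _ _ "p1 z" "p3 y"] T[of _ _ "p1 z" "p2 y"] T[of _ _ "p2 z" "p3 y"]
      T[of _ _ "p2 z" "p1 y"] T[of _ _ "p3 z" "p2 y"] T[of _ _ "p3 z" "p1 y"]
    by (simp add: field_simps)
qed

section \<open>Vector fields\<close>

text \<open>The product rule for the conjugate of V(\<tau>) by the curve: skewness of
  \<open>x\<close> turns the derivatives of the outer factors into a bracket.\<close>

lemma mult_conj_derivative:
  fixes a x V' :: "('n::finite) sqmat"
  assumes "x \<in> so" "(V has_vector_derivative V') (at 0)"
  shows "((\<lambda>\<tau>. (a ** mexp (\<tau> *\<^sub>R x)) ** V \<tau> ** transpose (a ** mexp (\<tau> *\<^sub>R x)))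
      has_vector_derivative a ** (commutator x (V 0) + V') ** transpose a) (at 0)"
proof -
  have c: "((\<lambda>\<tau>. a ** mexp (\<tau> *\<^sub>R x)) has_vector_derivative a ** x) (at 0)"
    by (rule mexp_derivative_0)
  have ct: "((\<lambda>\<tau>. transpose (a ** mexp (\<tau> *\<^sub>R x))) has_vector_derivative transpose (a ** x)) (at 0)"
    by (rule bounded_linear.has_vector_derivative[OF _ c])
      (simp add: linear_transpose flip: linear_conv_bounded_linear)
  have "((\<lambda>\<tau>. (a ** mexp (\<tau> *\<^sub>R x)) ** V \<tau> ** transpose (a ** mexp (\<tau> *\<^sub>R x))) has_vector_derivative
     (a ** mexp (0 *\<^sub>R x)) ** V 0 ** transpose (a ** x) +
     ((a ** mexp (0 *\<^sub>R x)) ** V' + (a ** x) ** V 0) ** transpose (a ** mexp (0 *\<^sub>R x))) (at 0)"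
    by (intro mm.has_vector_derivative c ct assms(2))
  moreover have "(a ** mexp (0 *\<^sub>R x)) ** V 0 ** transpose (a ** x) +
     ((a ** mexp (0 *\<^sub>R x)) ** V' + (a ** x) ** V 0) ** transpose (a ** mexp (0 *\<^sub>R x))
     = a ** (commutator x (V 0) + V') ** transpose a"
    using assms(1)
    by (simp add: mexp_zero so_iff commutator_def matrix_transpose_mul mm_simps matrix_mul_assoc)
  ultimately show ?thesis by (simp only:)
qed

context
  assumes card4: "4 \<le> CARD('n::finite)"
begin

lemma vector_field_mm: "vector_field X \<Longrightarrow> a \<in> SO \<Longrightarrow> X a \<in> \<mm>" for a :: "'n sqmat"
  by (simp add: vector_field_def)

lemma vector_field_so: "vector_field X \<Longrightarrow> a \<in> SO \<Longrightarrow> X a \<in> so" for a :: "'n sqmat"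
  by (rule so_subset[OF card4]) (rule vector_field_mm)

text \<open>The complement \<mm> is cut out by the linear equations \<open>pm w = w\<close> and
  \<open>transpose w = - w\<close>, which may be differentiated along the curve.\<close>

lemma vector_field_derivative:
  fixes Y :: "'n sqmat \<Rightarrow> 'n sqmat"
  assumes Y: "vector_field Y" and a: "a \<in> SO" and x: "x \<in> so"
  shows "\<exists>w\<in>\<mm>. ((\<lambda>\<tau>. Y (a ** mexp (\<tau> *\<^sub>R x))) has_vector_derivative w) (at 0)"
proof -
  have "smooth_on_SO Y" using Y by (simp add: vector_field_def)
  from smooth_on_SO_derivative[OF this a x] obtain w
    where w: "((\<lambda>\<tau>. Y (a ** mexp (\<tau> *\<^sub>R x))) has_vector_derivative w) (at 0)" by blast
  have m: "Y (a ** mexp (\<tau> *\<^sub>R x)) \<in> \<mm>" for \<tau>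
    by (rule vector_field_mm[OF Y SO_mult[OF a mexp_in_SO[OF x]]])
  have bl: "bounded_linear (pm :: 'n sqmat \<Rightarrow> _)" "bounded_linear (transpose :: 'n sqmat \<Rightarrow> _)"
    by (simp_all add: linear_pm linear_transpose flip: linear_conv_bounded_linear)
  have "((\<lambda>\<tau>. pm (Y (a ** mexp (\<tau> *\<^sub>R x)))) has_vector_derivative pm w) (at 0)"
    by (rule bounded_linear.has_vector_derivative[OF bl(1) w])
  moreover have "(\<lambda>\<tau>. pm (Y (a ** mexp (\<tau> *\<^sub>R x)))) = (\<lambda>\<tau>. Y (a ** mexp (\<tau> *\<^sub>R x)))"
    using m by (simp add: mm_iff[OF card4])
  ultimately have "((\<lambda>\<tau>. Y (a ** mexp (\<tau> *\<^sub>R x))) has_vector_derivative pm w) (at 0)" by (simp only:)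
  then have 1: "pm w = w" by (rule vector_derivative_unique_at) (rule w)
  have "((\<lambda>\<tau>. transpose (Y (a ** mexp (\<tau> *\<^sub>R x)))) has_vector_derivative transpose w) (at 0)"
    by (rule bounded_linear.has_vector_derivative[OF bl(2) w])
  moreover have "(\<lambda>\<tau>. transpose (Y (a ** mexp (\<tau> *\<^sub>R x)))) = (\<lambda>\<tau>. - Y (a ** mexp (\<tau> *\<^sub>R x)))"
    using m by (simp add: mm_iff[OF card4] so_iff)
  ultimately have "((\<lambda>\<tau>. - Y (a ** mexp (\<tau> *\<^sub>R x))) has_vector_derivative transpose w) (at 0)" by (simp only:)
  then have "transpose w = - w"
    by (rule vector_derivative_unique_at) (rule has_vector_derivative_minus[OF w])
  with 1 w show ?thesis by (auto simp: mm_iff[OF card4] so_iff)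
qed

lemma vector_field_f0:
  assumes "vector_field X" shows "vector_field (f0 \<circ> X :: 'n sqmat \<Rightarrow> 'n sqmat)"
  unfolding vector_field_def
proof (intro conjI ballI)
  show "smooth_on_SO (f0 \<circ> X)"
    unfolding o_def using assms
    by (intro smooth_on_SO_linear_comp[OF linear_f0[OF card4]]) (simp add: vector_field_def)
  show "(f0 \<circ> X) a \<in> \<mm>" if "a \<in> SO" for a
    using vector_field_mm[OF assms that] by (simp add: f0_in_mm[OF card4])
  show "(f0 \<circ> X) (a ** h) = Ad (matrix_inv h) ((f0 \<circ> X) a)" if "a \<in> SO" "h \<in> H" for a h
  proof -
    have "X (a ** h) = Ad (matrix_inv h) (X a)" using assms that by (simp add: vector_field_def)
    moreover have "matrix_inv h \<in> H"
      using that(2) by (simp add: SO_inv[OF card4] H_D[OF card4] H_transpose[OF card4])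
    ultimately show ?thesis by (simp add: f0_Ad[OF card4])
  qed
qed

text \<open>This is \<theta> - 1 applied to the fundamental field of \<open>W\<close>, whose lift is
  the \<mm>-part of a^T W a. Using \<phi> - 1 puts the values in \<mm> directly, and equivariance
  holds because \<phi> commutes with Ad(H).\<close>

lemma vector_field_fundamental:
  fixes W :: "'n sqmat"
  assumes "W \<in> so"
  shows "vector_field (\<lambda>a. phi (transpose a ** W ** a) - transpose a ** W ** a)"
  unfolding vector_field_def
proof (intro conjI ballI)
  have "bilinear (\<lambda>(a :: 'n sqmat) (b :: 'n sqmat). transpose a ** W ** b)"
    unfolding bilinear_def by (auto intro!: linearI simp: transpose_linear_simps mm_simps)
  then have "smooth_on_SO (\<lambda>a. transpose a ** W ** a)" by (rule smooth_on_SO_quadratic)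
  moreover have "linear (\<lambda>Z :: 'n sqmat. phi Z - Z)"
    by (intro linear_compose_sub linear_phi[OF card4] linear_ident)
  ultimately show "smooth_on_SO (\<lambda>a. phi (transpose a ** W ** a) - transpose a ** W ** a)"
    by (rule smooth_on_SO_linear_comp[rotated])
  fix a :: "'n sqmat" assume a: "a \<in> SO"
  have "transpose a ** W ** a \<in> so"
    using assms by (simp add: so_iff matrix_transpose_mul mm_simps matrix_mul_assoc)
  then show "phi (transpose a ** W ** a) - transpose a ** W ** a \<in> \<mm>"
    unfolding \<mm>_def by (rule imageI)
  fix h :: "'n sqmat" assume h: "h \<in> H"
  have ih: "matrix_inv h \<in> H" "matrix_inv h = transpose h"
    using h by (simp_all add: SO_inv[OF card4] H_D[OF card4] H_transpose[OF card4])
  have "Ad (matrix_inv h) Z = transpose h ** Z ** h" for Z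
    using ih(2) H_D(1)[OF card4 ih(1)] by (simp add: Ad_eq[OF card4])
  then have "transpose (a ** h) ** W ** (a ** h) = Ad (matrix_inv h) (transpose a ** W ** a)"
    by (simp add: matrix_transpose_mul matrix_mul_assoc)
  moreover have "Ad (matrix_inv h) (Z - Z') = Ad (matrix_inv h) Z - Ad (matrix_inv h) Z'" for Z Z'
    by (simp add: Ad_def mm_simps)
  ultimately show "phi (transpose (a ** h) ** W ** (a ** h)) - transpose (a ** h) ** W ** (a ** h) =
      Ad (matrix_inv h) (phi (transpose a ** W ** a) - transpose a ** W ** a)"
    by (simp add: phi_Ad[OF card4 ih(1)])
qed

text \<open>Every tangent value is realised by a field, which turns conditions on fields into
  conditions on vectors of \<mm>. Conjugating by \<open>a\<close> cancels the conjugation in the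
  field at that point.\<close>

lemma ex_vector_field:
  fixes v :: "'n sqmat"
  assumes "v \<in> \<mm>" "a \<in> SO" shows "\<exists>X. vector_field X \<and> X a = v"
proof -
  obtain Y where Y: "Y \<in> so" "v = phi Y - Y" using assms(1) unfolding \<mm>_def by blast
  let ?W = "a ** Y ** transpose a"
  have W: "?W \<in> so" using Y(1) by (simp add: so_iff matrix_transpose_mul mm_simps matrix_mul_assoc)
  have "transpose a ** ?W ** a = (transpose a ** a) ** Y ** (transpose a ** a)"
    by (simp only: matrix_mul_assoc)
  then have "transpose a ** ?W ** a = Y" by (simp add: SO_orth[OF assms(2)])
  then show ?thesis using vector_field_fundamental[OF W] Y(2) by auto
qed

text \<open>Right invariance holds because \<open>H\<close> centralizes \<open>B\<close>.\<close>

lemma test_function: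
  fixes Q :: "'n sqmat"
  shows "smooth_function (\<lambda>b. Q \<bullet> (b ** B ** transpose b))"
  unfolding smooth_function_def
proof (intro conjI ballI)
  have "bilinear (\<lambda>(a :: 'n sqmat) (b :: 'n sqmat). Q \<bullet> (a ** B ** transpose b))"
    unfolding bilinear_def
    by (auto intro!: linearI simp: transpose_linear_simps mm_simps inner_add_right)
  then show "smooth_on_SO (\<lambda>b. Q \<bullet> (b ** B ** transpose b))"
    by (rule smooth_on_SO_quadratic)
  fix a h :: "'n sqmat" assume h: "h \<in> H"
  have "h ** B = B ** h" using H_D(2)[OF card4 h] by (simp add: phi_fixed_iff[OF card4])
  then have "a ** h ** B ** transpose (a ** h) = a ** B ** (h ** transpose h) ** transpose a"
    by (simp add: matrix_transpose_mul matrix_mul_assoc) (simp flip: matrix_mul_assoc)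
  then show "Q \<bullet> (a ** h ** B ** transpose (a ** h)) = Q \<bullet> (a ** B ** transpose a)"
    by (simp add: SO_orth[OF H_D(1)[OF card4 h]])
qed

lemma derivation_test:
  fixes Q :: "'n sqmat"
  assumes "X a \<in> so"
  shows "derivation X (\<lambda>b. Q \<bullet> (b ** B ** transpose b)) a = Q \<bullet> (a ** commutator (X a) B ** transpose a)"
proof -
  have "((\<lambda>\<tau>. (a ** mexp (\<tau> *\<^sub>R X a)) ** B ** transpose (a ** mexp (\<tau> *\<^sub>R X a)))
      has_vector_derivative a ** (commutator (X a) B + 0) ** transpose a) (at 0)"
    by (rule mult_conj_derivative[OF assms, of "\<lambda>_. B"]) simp
  from bounded_linear.has_vector_derivative[OF bounded_linear_inner_right this, of Q]
  show ?thesis unfolding derivation_def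
    by (intro DERIV_imp_deriv) (simp add: has_real_derivative_iff_has_vector_derivative)
qed

text \<open>The first derivative has again the form of a conjugated matrix, with [Y, B] in place of
  \<open>B\<close>, so the same product rule applies once more.\<close>

lemma derivation_derivation_test:
  fixes Q :: "'n sqmat"
  assumes X: "X a \<in> so" and Y: "\<And>b. b \<in> SO \<Longrightarrow> Y b \<in> so" and a: "a \<in> SO"
    and w: "((\<lambda>\<tau>. Y (a ** mexp (\<tau> *\<^sub>R X a))) has_vector_derivative w) (at 0)"
  shows "derivation X (derivation Y (\<lambda>b. Q \<bullet> (b ** B ** transpose b))) a =
    Q \<bullet> (a ** (commutator (X a) (commutator (Y a) B) + commutator w B) ** transpose a)"
proof -
  let ?c = "\<lambda>\<tau>. a ** mexp (\<tau> *\<^sub>R X a)"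
  have lin: "bounded_linear (\<lambda>Z. commutator Z (B :: 'n sqmat))"
    by (simp add: linearI commutator_linear_simps flip: linear_conv_bounded_linear)
  have "((\<lambda>\<tau>. ?c \<tau> ** commutator (Y (?c \<tau>)) B ** transpose (?c \<tau>))
      has_vector_derivative a ** (commutator (X a) (commutator (Y (?c 0)) B) + commutator w B) ** transpose a) (at 0)"
    by (rule mult_conj_derivative[OF X bounded_linear.has_vector_derivative[OF lin w]])
  from bounded_linear.has_vector_derivative[OF bounded_linear_inner_right this, of Q]
  have "((\<lambda>\<tau>. Q \<bullet> (?c \<tau> ** commutator (Y (?c \<tau>)) B ** transpose (?c \<tau>)))
    has_real_derivative Q \<bullet> (a ** (commutator (X a) (commutator (Y a) B) + commutator w B) ** transpose a)) (at 0)"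
    by (simp add: has_real_derivative_iff_has_vector_derivative mexp_zero)
  moreover have "derivation Y (\<lambda>b. Q \<bullet> (b ** B ** transpose b)) (?c \<tau>) =
      Q \<bullet> (?c \<tau> ** commutator (Y (?c \<tau>)) B ** transpose (?c \<tau>))" for \<tau>
    by (rule derivation_test) (rule Y[OF SO_mult[OF a mexp_in_SO[OF X]]])
  ultimately show ?thesis unfolding derivation_def[of X] by (intro DERIV_imp_deriv) (simp only:)
qed

text \<open>Injectivity of the differential of the immersion: a matrix that commutes with
  \<open>B\<close> is fixed by \<phi>, hence block diagonal.\<close>

lemma commutator_B_zero:
  fixes v :: "'n sqmat"
  assumes "commutator v B = 0" shows "pm v = 0"
proof -
  have "phi v = v" using assms by (simp add: phi_fixed_iff[OF card4] commutator_def)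
  then show ?thesis by (intro pm_block_diag phi_fixed_block_diag[OF card4])
qed

end

section \<open>The Levi-Civita connection\<close>

context
  assumes card4: "4 \<le> CARD('n::finite)"
begin

text \<open>The factor is c (n - 2), where n - 2 comes from the Killing form.\<close>

lemma characteristic_form:
  fixes g :: "'n sqmat \<Rightarrow> 'n sqmat \<Rightarrow> real"
  assumes "characteristic_numbers g (s, t)"
  shows "\<exists>\<kappa>>0. \<forall>x\<in>\<mm>. \<forall>y\<in>\<mm>. g x y = \<kappa> * Qf s t x y"
proof -
  obtain c where c: "c > 0" "\<And>X1 X2 X3 Y1 Y2 Y3. \<lbrakk>X1 \<in> \<mm>1; X2 \<in> \<mm>2; X3 \<in> \<mm>3; Y1 \<in> \<mm>1; Y2 \<in> \<mm>2; Y3 \<in> \<mm>3\<rbrakk> \<Longrightarrow>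
      g (X1 + X2 + X3) (Y1 + Y2 + Y3) = c * (g0 X1 Y1 + s * g0 X2 Y2 + t * g0 X3 Y3)"
    using assms unfolding characteristic_numbers_def by auto
  let ?\<kappa> = "c * (real CARD('n) - 2)"
  have "g x y = ?\<kappa> * Qf s t x y" if x: "x \<in> \<mm>" and y: "y \<in> \<mm>" for x y
  proof -
    have so: "x \<in> so" "y \<in> so" using x y by (simp_all add: so_subset[OF card4])
    have m: "p1 z \<in> \<mm>1" "p2 z \<in> \<mm>2" "p3 z \<in> \<mm>3" if "z \<in> so" for z :: "'n sqmat"
      using that
      by (simp_all add: mm1_iff[OF card4] mm2_iff[OF card4] mm3_iff[OF card4] block_in_so block_block)
    have "g x y = g (p1 x + p2 x + p3 x) (p1 y + p2 y + p3 y)"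
      using mm_decomp[OF card4 x] mm_decomp[OF card4 y] by (rule arg_cong2)
    also have "\<dots> = c * (g0 (p1 x) (p1 y) + s * g0 (p2 x) (p2 y) + t * g0 (p3 x) (p3 y))"
      by (intro c(2) m so)
    also have "\<dots> = c * ((real CARD('n) - 2) * (p1 x \<bullet> p1 y) + s * ((real CARD('n) - 2) * (p2 x \<bullet> p2 y))
        + t * ((real CARD('n) - 2) * (p3 x \<bullet> p3 y)))"
      by (simp only: g0_so[OF block_in_so[OF so(1)] block_in_so[OF so(2)]])
    also have "\<dots> = ?\<kappa> * (p1 x \<bullet> p1 y + s * (p2 x \<bullet> p2 y) + t * (p3 x \<bullet> p3 y))"
      by (simp only: distrib_left mult_ac)
    also have "\<dots> = ?\<kappa> * Qf s t x y"
      by (simp only: Qf_def inner_block[symmetric] block_block)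
    finally show ?thesis .
  qed
  moreover have "?\<kappa> > 0" using c(1) card4 by simp
  ultimately show ?thesis by blast
qed

lemma derivation_metric:
  fixes g :: "'n sqmat \<Rightarrow> 'n sqmat \<Rightarrow> real"
  assumes g: "\<And>x y. x \<in> \<mm> \<Longrightarrow> y \<in> \<mm> \<Longrightarrow> g x y = \<kappa> * Qf s t x y"
    and vf: "vector_field X" "vector_field Y" "vector_field Z" and a: "a \<in> SO"
    and u: "((\<lambda>\<tau>. Y (a ** mexp (\<tau> *\<^sub>R X a))) has_vector_derivative u) (at 0)"
    and w: "((\<lambda>\<tau>. Z (a ** mexp (\<tau> *\<^sub>R X a))) has_vector_derivative w) (at 0)"
  shows "derivation X (\<lambda>b. g (Y b) (Z b)) a = \<kappa> * (Qf s t u (Z a) + Qf s t (Y a) w)"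
proof -
  let ?c = "\<lambda>\<tau>. a ** mexp (\<tau> *\<^sub>R X a)"
  have "?c \<tau> \<in> SO" for \<tau>
    by (intro SO_mult a mexp_in_SO vector_field_so[OF card4 vf(1)])
  then have eq: "g (Y (?c \<tau>)) (Z (?c \<tau>)) = \<kappa> * Qf s t (Y (?c \<tau>)) (Z (?c \<tau>))" for \<tau>
    by (intro g vector_field_mm[OF card4] vf)
  have "((\<lambda>\<tau>. Qf s t (Y (?c \<tau>)) (Z (?c \<tau>))) has_vector_derivative
      Qf s t (Y (?c 0)) w + Qf s t u (Z (?c 0))) (at 0)"
    by (rule bounded_bilinear.has_vector_derivative[OF bounded_bilinear_Qf u w])
  then have "((\<lambda>\<tau>. Qf s t (Y (?c \<tau>)) (Z (?c \<tau>))) has_real_derivative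
      Qf s t u (Z a) + Qf s t (Y a) w) (at 0)"
    by (simp add: has_real_derivative_iff_has_vector_derivative mexp_zero add.commute)
  from DERIV_cmult[OF this, of \<kappa>] show ?thesis
    unfolding derivation_def eq by (rule DERIV_imp_deriv)
qed

text \<open>Applying the bracket identity to the test functions and using Jacobi shows that
  \<open>?v\<close> commutes with \<open>B\<close>, so its \<mm>-component vanishes.\<close>

lemma torsion_value:
  fixes X Y Z :: "'n sqmat \<Rightarrow> 'n sqmat"
  assumes vf: "vector_field X" "vector_field Y" and Z: "\<And>b. b \<in> SO \<Longrightarrow> Z b \<in> \<mm>" and a: "a \<in> SO"
    and br: "is_lie_bracket X Y Z"
    and u: "((\<lambda>\<tau>. Y (a ** mexp (\<tau> *\<^sub>R X a))) has_vector_derivative u) (at 0)" "u \<in> \<mm>"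
    and w: "((\<lambda>\<tau>. X (a ** mexp (\<tau> *\<^sub>R Y a))) has_vector_derivative w) (at 0)" "w \<in> \<mm>"
  shows "Z a = u - w + pm (commutator (X a) (Y a))"
proof -
  note so = vector_field_so[OF card4 vf(1)] vector_field_so[OF card4 vf(2)]
  let ?v = "Z a - (u - w) - commutator (X a) (Y a)"
  have "Q \<bullet> (a ** commutator ?v B ** transpose a) = 0" for Q
  proof -
    let ?u = "\<lambda>b. Q \<bullet> (b ** B ** transpose b)"
    have "derivation Z ?u a = derivation X (derivation Y ?u) a - derivation Y (derivation X ?u) a"
      using br test_function[OF card4, of Q] a unfolding is_lie_bracket_def by blast
    then have "Q \<bullet> (a ** commutator (Z a) B ** transpose a) =
       Q \<bullet> (a ** (commutator (X a) (commutator (Y a) B) + commutator u B) ** transpose a) -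
       Q \<bullet> (a ** (commutator (Y a) (commutator (X a) B) + commutator w B) ** transpose a)"
      using derivation_test[of Z a Q, OF card4 so_subset[OF card4 Z[OF a]]]
        derivation_derivation_test[of X a Y u Q, OF card4 so(1)[OF a] so(2) a u(1)]
        derivation_derivation_test[of Y a X w Q, OF card4 so(2)[OF a] so(1) a w(1)]
      by (simp only:)
    then show ?thesis
      by (simp add: commutator_jacobi[symmetric] commutator_linear_simps mm_simps inner_diff_right
          inner_add_right algebra_simps)
  qed
  \<comment> \<open>Choosing the matrix itself for Q makes its squared norm vanish.\<close>
  from this[of "a ** commutator ?v B ** transpose a"]
  have "a ** commutator ?v B ** transpose a = 0" by simp
  then have "transpose a ** (a ** commutator ?v B ** transpose a) ** a = 0" by simp
  moreover have "transpose a ** (a ** K ** transpose a) ** a = (transpose a ** a) ** K ** (transpose a ** a)" for K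
    by (simp only: matrix_mul_assoc)
  ultimately have "commutator ?v B = 0" by (simp add: SO_orth[OF a])
  then have "pm ?v = 0" by (rule commutator_B_zero[OF card4])
  then have "Z a - (u - w) = pm (commutator (X a) (Y a))"
    using Z[OF a] u(2) w(2) by (simp add: linear_diff[OF linear_pm] mm_iff[OF card4])
  then show ?thesis unfolding diff_eq_eq by (simp only: add.commute[of "u - w"])
qed

context
  fixes g :: "'n sqmat \<Rightarrow> 'n sqmat \<Rightarrow> real" and s t :: real
    and D :: "('n sqmat \<Rightarrow> 'n sqmat) \<Rightarrow> ('n sqmat \<Rightarrow> 'n sqmat) \<Rightarrow> ('n sqmat \<Rightarrow> 'n sqmat)"
  assumes cn: "characteristic_numbers g (s, t)" and lc: "levi_civita g D"
begin

lemma st_pos: "s > 0" "t > 0"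
  using cn by (auto simp: characteristic_numbers_def)

text \<open>The difference of the two sides is symmetric in \<open>X, Y\<close> (vanishing torsion) and skew in
  \<open>Y, Z\<close> (metricity), hence zero.\<close>

lemma levi_civita_formula:
  assumes X: "vector_field X" and Y: "vector_field Y" and a: "a \<in> SO"
    and w: "((\<lambda>\<tau>. Y (a ** mexp (\<tau> *\<^sub>R X a))) has_vector_derivative w) (at 0)"
  shows "D X Y a = w + Lam s t (X a) (Y a)"
proof -
  obtain \<kappa> where k: "\<kappa> > 0" "\<And>x y. x \<in> \<mm> \<Longrightarrow> y \<in> \<mm> \<Longrightarrow> g x y = \<kappa> * Qf s t x y"
    using characteristic_form[OF cn] by blast
  have vD: "vector_field (D X Y)" if "vector_field X" "vector_field Y" for X Y
    using lc that by (simp add: levi_civita_def affine_connection_def)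
  define d where "d X Y = vector_derivative (\<lambda>\<tau>. Y (a ** mexp (\<tau> *\<^sub>R X a))) (at 0)"
    for X Y :: "'n sqmat \<Rightarrow> 'n sqmat"
  have d: "((\<lambda>\<tau>. Y (a ** mexp (\<tau> *\<^sub>R X a))) has_vector_derivative d X Y) (at 0)" "d X Y \<in> \<mm>"
    if "vector_field X" "vector_field Y" for X Y
    using vector_field_derivative[OF card4 that(2) a vector_field_so[OF card4 that(1) a]]
    by (auto simp: d_def vector_derivative_at)
  \<comment> \<open>The deviation of the given connection from the candidate, at the point
    \<open>a\<close>.\<close>
  define S where "S X Y = D X Y a - (d X Y + Lam s t (X a) (Y a))" for X Y
  note m = vector_field_mm[OF card4 _ a] and so = vector_field_so[OF card4 _ a]
  have Lm: "Lam s t (X a) (Y a) \<in> \<mm>" if "vector_field X" "vector_field Y" for X Y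
    using that by (simp add: mm_iff[OF card4] pm_Lam Lam_in_so so)
  have Sm: "S X Y \<in> \<mm>" if "vector_field X" "vector_field Y" for X Y
    unfolding S_def using that
    by (intro subspace_diff[OF subspace_mm[OF card4]] subspace_add[OF subspace_mm[OF card4]] d Lm m vD)
  have skew: "Qf s t (S X Y) (Z a) = - Qf s t (S X Z) (Y a)"
    if v: "vector_field X" "vector_field Y" "vector_field Z" for X Y Z
  proof -
    have "derivation X (\<lambda>b. g (Y b) (Z b)) a = g (D X Y a) (Z a) + g (Y a) (D X Z a)"
      using lc v a unfolding levi_civita_def by blast
    then have "\<kappa> * (Qf s t (d X Y) (Z a) + Qf s t (Y a) (d X Z)) =
        \<kappa> * Qf s t (D X Y a) (Z a) + \<kappa> * Qf s t (Y a) (D X Z a)"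
      by (simp only: derivation_metric[OF k(2) v a d(1)[OF v(1,2)] d(1)[OF v(1,3)]]
          k(2)[OF m[OF vD[OF v(1,2)]] m[OF v(3)]] k(2)[OF m[OF v(2)] m[OF vD[OF v(1,3)]]])
    then have "Qf s t (d X Y) (Z a) + Qf s t (Y a) (d X Z) =
        Qf s t (D X Y a) (Z a) + Qf s t (Y a) (D X Z a)"
      using k(1) by (simp only: distrib_left[symmetric] mult_cancel_left) simp
    moreover have "Qf s t (Lam s t (X a) (Y a)) (Z a) + Qf s t (Y a) (Lam s t (X a) (Z a)) = 0"
      by (rule Lam_metric[OF st_pos so[OF v(1)]])
    moreover have "Qf s t (S X Z) (Y a) = Qf s t (Y a) (S X Z)" by (rule Qf_sym)
    ultimately show ?thesis
      by (simp add: S_def Qf_diff Qf_add)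
  qed
  have sym: "S X Y = S Y X" if v: "vector_field X" "vector_field Y" for X Y
  proof -
    have br: "is_lie_bracket X Y (\<lambda>a. D X Y a - D Y X a)"
      using lc v by (simp add: levi_civita_def)
    have "D X Y a - D Y X a = d X Y - d Y X + pm (commutator (X a) (Y a))"
    proof (rule torsion_value[OF v _ a br d[OF v] d[OF v(2,1)]])
      show "D X Y b - D Y X b \<in> \<mm>" if "b \<in> SO" for b
        using vector_field_mm[OF card4 vD[OF v] that] vector_field_mm[OF card4 vD[OF v(2,1)] that]
        by (rule subspace_diff[OF subspace_mm[OF card4]])
    qed
    moreover have "Lam s t (X a) (Y a) - Lam s t (Y a) (X a) = pm (commutator (X a) (Y a))"
      using m[OF v(1)] m[OF v(2)] by (simp add: Lam_torsion mm_iff[OF card4])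
    ultimately show ?thesis by (simp add: S_def algebra_simps)
  qed
  \<comment> \<open>A field with value \<open>S X Y\<close> at \<open>a\<close> as third argument;
    applying skewness and symmetry alternately shows that the squared length of \<open>S X Y\<close>
    equals its own negative.\<close>
  obtain Z where Z: "vector_field Z" "Z a = S X Y"
    using ex_vector_field[OF card4 Sm[OF X Y] a] by blast
  have "Qf s t (S X Y) (Z a) = - Qf s t (S X Z) (Y a)" by (rule skew[OF X Y Z(1)])
  also have "\<dots> = - Qf s t (S Z X) (Y a)" by (simp only: sym[OF X Z(1)])
  also have "\<dots> = Qf s t (S Z Y) (X a)" using skew[OF Z(1) X Y] by simp
  also have "\<dots> = Qf s t (S Y Z) (X a)" by (simp only: sym[OF Y Z(1)])
  also have "\<dots> = - Qf s t (S Y X) (Z a)" by (rule skew[OF Y Z(1) X])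
  also have "\<dots> = - Qf s t (S X Y) (Z a)" by (simp only: sym[OF X Y])
  finally have "Qf s t (S X Y) (S X Y) = 0" by (simp add: Z(2))
  then have "S X Y = 0"
    using Sm[OF X Y] by (intro Qf_definite[OF st_pos]) (simp_all add: mm_iff[OF card4])
  moreover have "d X Y = w" unfolding d_def by (rule vector_derivative_at[OF w])
  ultimately show ?thesis by (simp add: S_def)
qed

section \<open>The covariant derivative of \<open>f0\<close>\<close>

definition nabla_f :: "'n sqmat \<Rightarrow> 'n sqmat \<Rightarrow> 'n sqmat" where
  "nabla_f x y = Lam s t x (f0 y) - f0 (Lam s t x y)"

text \<open>As \<open>f0\<close> is one fixed linear map, the derivative of
  \<open>f0 \<circ> Y\<close> along the curve is \<open>f0 w\<close>, which cancels; only the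
  algebraic part of the connection survives.\<close>

lemma cov_deriv_f0:
  assumes X: "vector_field X" and Y: "vector_field Y" and a: "a \<in> SO"
  shows "cov_deriv_f D f0 X Y a = nabla_f (X a) (Y a)"
proof -
  obtain w where w: "((\<lambda>\<tau>. Y (a ** mexp (\<tau> *\<^sub>R X a))) has_vector_derivative w) (at 0)"
    using vector_field_derivative[OF card4 Y a vector_field_so[OF card4 X a]] by blast
  have "bounded_linear (f0 :: 'n sqmat \<Rightarrow> _)"
    by (simp add: linear_f0[OF card4] flip: linear_conv_bounded_linear)
  from bounded_linear.has_vector_derivative[OF this w]
  have "((\<lambda>\<tau>. (f0 \<circ> Y) (a ** mexp (\<tau> *\<^sub>R X a))) has_vector_derivative f0 w) (at 0)"
    by (simp only: o_def)
  then have 1: "D X (f0 \<circ> Y) a = f0 w + Lam s t (X a) ((f0 \<circ> Y) a)"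
    by (rule levi_civita_formula[OF X vector_field_f0[OF card4 Y] a])
  show ?thesis
    unfolding cov_deriv_f_def nabla_f_def 1 levi_civita_formula[OF X Y a w]
    by (simp add: f0_linear_simps[OF card4])
qed

lemma nabla_f_diag:
  "nabla_f x x = ((s - 1) / t) *\<^sub>R commutator (p1 x) (phi (p2 x))
    + ((3 * (t - s) - 1) / 2) *\<^sub>R commutator (phi (p2 x)) (p3 x)
    + ((3 * (t - 1) / s - 1) / 2) *\<^sub>R commutator (phi (p1 x)) (p3 x)"
proof -
  let ?A = "commutator (phi (p2 x)) (p3 x)" and ?B = "commutator (phi (p1 x)) (p3 x)"
  let ?C = "commutator (p1 x) (phi (p2 x))"
  have pf: "p1 (f0 x) = phi (p1 x)" "p2 (f0 x) = phi (p2 x)" "p3 (f0 x) = 0"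
    by (simp_all only: f0_block[OF card4, symmetric] f0_p1[OF card4] f0_p2[OF card4] f0_p3[OF card4])
  \<comment> \<open>The bracket of \<open>phi (p1 x)\<close> and \<open>p2 x\<close> lies in the
    third summand, where \<phi> = -1. Applying \<phi> to it and using \<phi>^2 = -1 on the first
    summand moves \<phi> to the other argument.\<close>
  have c21: "commutator (phi (p1 x)) (p2 x) = ?C"
  proof -
    have "phi (p3 (commutator (p1 (phi x)) (p2 x))) = - p3 (commutator (p1 (phi x)) (p2 x))"
      by (rule phi_p3[OF card4])
    then have "phi (commutator (p1 (phi x)) (p2 x)) = - commutator (p1 (phi x)) (p2 x)"
      by (simp only: p_of_commutator)
    then have "commutator (phi (phi (p1 x))) (phi (p2 x)) = - commutator (phi (p1 x)) (p2 x)"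
      by (simp only: phi_commutator[OF card4] phi_block[OF card4, symmetric])
    then show ?thesis by (simp add: phi_phi_p1[OF card4] commutator_linear_simps)
  qed
  \<comment> \<open>The bracket lies in the first summand, so \<open>f0\<close> acts on it as the
    automorphism \<phi>, which negates \<open>p3 x\<close>.\<close>
  have f23: "f0 (commutator (p2 x) (p3 x)) = - ?A"
  proof -
    have "f0 (p1 (commutator (p2 x) (p3 x))) = phi (p1 (commutator (p2 x) (p3 x)))"
      by (rule f0_p1[OF card4])
    then show ?thesis
      by (simp only: p_of_commutator phi_commutator[OF card4] phi_p3[OF card4] commutator_linear_simps)
  qed
  have f13: "f0 (commutator (p1 x) (p3 x)) = - ?B"
  proof -
    have "f0 (p2 (commutator (p1 x) (p3 x))) = phi (p2 (commutator (p1 x) (p3 x)))"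
      by (rule f0_p2[OF card4])
    then show ?thesis
      by (simp only: p_of_commutator phi_commutator[OF card4] phi_p3[OF card4] commutator_linear_simps)
  qed
  have f12: "f0 (commutator (p1 x) (p2 x)) = 0"
    using f0_p3[OF card4, of "commutator (p1 x) (p2 x)"] by (simp only: p_of_commutator)
  have L1: "Lam s t x (f0 x) = (- ((1 + (s - t)) / 2)) *\<^sub>R ?A + (- ((1 + (1 - t) / s) / 2)) *\<^sub>R ?B +
      ((1 + (s - 1) / t) / 2) *\<^sub>R ?C + (- ((1 + (1 - s) / t) / 2)) *\<^sub>R ?C"
    unfolding Lam_def pf commutator_swap[of "p3 x"] commutator_swap[of "p2 x" "phi (p1 x)"] c21
    by (simp add: commutator_linear_simps)
  have L2: "f0 (Lam s t x x) = ((1 + (t - s)) / 2) *\<^sub>R (- ?A) + ((1 + (s - t)) / 2) *\<^sub>R ?A +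
      ((1 + (t - 1) / s) / 2) *\<^sub>R (- ?B) + ((1 + (1 - t) / s) / 2) *\<^sub>R ?B"
    unfolding Lam_def commutator_swap[of "p3 x"] commutator_swap[of "p2 x" "p1 x"]
    by (simp only: f0_linear_simps[OF card4] f23 f13 f12 scaleR_zero_right minus_zero add_0_right minus_minus)
  have e: "nabla_f x x = (((1 + (s - 1) / t) / 2) + (- ((1 + (1 - s) / t) / 2))) *\<^sub>R ?C
    + ((- ((1 + (s - t)) / 2)) + ((1 + (t - s)) / 2) - ((1 + (s - t)) / 2)) *\<^sub>R ?A
    + ((- ((1 + (1 - t) / s) / 2)) + ((1 + (t - 1) / s) / 2) - ((1 + (1 - t) / s) / 2)) *\<^sub>R ?B"
  proof -
    have "(a1 *\<^sub>R A + b1 *\<^sub>R B + c1 *\<^sub>R C + c2 *\<^sub>R C) - (a2 *\<^sub>R (- A) + a3 *\<^sub>R A + b2 *\<^sub>R (- B) + b3 *\<^sub>R B)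
      = (c1 + c2) *\<^sub>R C + (a1 + a2 - a3) *\<^sub>R A + (b1 + b2 - b3) *\<^sub>R B"
      for a1 a2 a3 b1 b2 b3 c1 c2 and A B C :: "'n sqmat"
      by (simp add: scaleR_add_left scaleR_diff_left)
    then show ?thesis unfolding nabla_f_def L1 L2 .
  qed
  have c: "((1 + (s - 1) / t) / 2) + (- ((1 + (1 - s) / t) / 2)) = (s - 1) / t"
    "(- ((1 + (s - t)) / 2)) + ((1 + (t - s)) / 2) - ((1 + (s - t)) / 2) = (3 * (t - s) - 1) / 2"
    "(- ((1 + (1 - t) / s) / 2)) + ((1 + (t - 1) / s) / 2) - ((1 + (1 - t) / s) / 2) = (3 * (t - 1) / s - 1) / 2"
    using st_pos by (simp_all add: field_simps)
  show ?thesis unfolding e c ..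
qed

text \<open>Skewness for the Frobenius product passes to every weighted summand, because
  \<open>f0\<close> commutes with the blocks.\<close>

lemma f0_metric: "metric_f_structure g (f0 :: 'n sqmat \<Rightarrow> _)"
  unfolding metric_f_structure_def
proof (intro conjI allI impI ballI)
  show "f_structure (f0 :: 'n sqmat \<Rightarrow> _)" by (rule f0_f_structure[OF card4])
  fix X Y :: "'n sqmat \<Rightarrow> 'n sqmat" and a :: "'n sqmat"
  assume "vector_field X" "vector_field Y" "a \<in> SO"
  then have m: "X a \<in> \<mm>" "Y a \<in> \<mm>" by (simp_all add: vector_field_mm[OF card4])
  obtain \<kappa> where k: "\<And>x y. x \<in> \<mm> \<Longrightarrow> y \<in> \<mm> \<Longrightarrow> g x y = \<kappa> * Qf s t x y"
    using characteristic_form[OF cn] by blast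
  have "block k l (f0 (X a)) \<bullet> Y a = - (block k l (X a) \<bullet> f0 (Y a))" for k l
    by (simp only: f0_block[OF card4, symmetric] f0_skew[OF card4])
  then have "Qf s t (f0 (X a)) (Y a) = - Qf s t (X a) (f0 (Y a))"
    by (simp add: Qf_def)
  then show "g (f0 (X a)) (Y a) + g (X a) (f0 (Y a)) = 0"
    using m by (simp add: k f0_in_mm[OF card4])
qed

text \<open>On the first two summands the inverse of \<open>f0\<close> is \<open>- f0\<close>; so
  vectors there can be prescribed as values of \<open>f0 \<circ> X\<close>.\<close>

lemma f0_f0: "p3 y = 0 \<Longrightarrow> y \<in> \<mm> \<Longrightarrow> f0 (- f0 y) = y" for y :: "'n sqmat"
proof -
  assume "p3 y = 0" "y \<in> \<mm>"
  then have y: "y = p1 y + p2 y" using mm_decomp[OF card4, of y] by simp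
  have "f0 (f0 (p1 y + p2 y)) = - (p1 y + p2 y)"
    by (simp add: f0_linear_simps[OF card4] f0_p1[OF card4] f0_p2[OF card4] phi_block[OF card4])
      (simp add: f0_p1[OF card4] f0_p2[OF card4] phi_phi_p1[OF card4] phi_phi_p2[OF card4]
        flip: phi_block[OF card4])
  then show ?thesis using y by (metis f0_linear_simps(3)[OF card4] minus_minus)
qed

section \<open>Vectors that isolate single coefficients\<close>

lemma coord4_neq: "coord 1 \<noteq> (coord 4 :: 'n)" "coord 3 \<noteq> (coord 4 :: 'n)" "coord 1 \<noteq> (coord 3 :: 'n)"
proof -
  have "cls (coord 1 :: 'n) \<noteq> cls (coord 4 :: 'n)" "cls (coord 3 :: 'n) \<noteq> cls (coord 4 :: 'n)"
    by (simp_all add: cls_coord4[OF card4] cls_simps[OF card4] del: One_nat_def)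
  then show "coord 1 \<noteq> (coord 4 :: 'n)" "coord 3 \<noteq> (coord 4 :: 'n)" by auto
qed (rule coord_distinct[OF card4])

lemma ex_commutator_12: "\<exists>x\<in>\<mm>. p3 x = 0 \<and> commutator (p1 x) (phi (p2 x)) \<noteq> (0 :: 'n sqmat)"
proof -
  define x y where "x = skw (coord 1) (coord 3 :: 'n)" and "y = skw (coord 3) (coord 4 :: 'n)"
  \<comment> \<open>Since \<phi>^2 y = - y, applying \<phi> to the second component
    \<open>- phi y\<close> gives back \<open>y\<close>, and the bracket in question is
    [x, y].\<close>
  let ?z = "x - phi y"
  have so: "x \<in> so" "y \<in> so" by (simp_all only: x_def y_def skw_in_so)
  have y: "p2 y = y" and x: "p1 x = x" by (simp_all only: x_def y_def skw_coord[OF card4])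
  have y': "p1 y = 0" "p3 y = 0" and x': "p2 x = 0" "p3 x = 0"
    using p_p(1,6)[of y] p_p(3,5)[of x] by (simp_all only: x y)
  have "p1 ?z = x" "p2 ?z = - phi y" "p3 ?z = 0"
    by (simp_all add: block_linear_simps x y x' y' phi_linear_simps[OF card4] flip: phi_block[OF card4])
  moreover have "phi (phi y) = - y" using phi_phi_p2[OF card4, of y] by (simp only: y)
  moreover have "commutator x y \<noteq> 0"
    using commutator_skw_nth[of "coord 1" "coord 3" "coord 4 :: 'n"] coord4_neq
    by (auto simp: x_def y_def)
  moreover have "?z \<in> so"
    by (intro subspace_diff[OF subspace_so] so phi_in_so[OF card4])
  ultimately show ?thesis
    by (intro bexI[of _ ?z]) (simp_all add: phi_linear_simps[OF card4] mm_iff[OF card4] pm_def)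
qed

lemma ex_commutator_13: "\<exists>x\<in>\<mm>. p2 x = 0 \<and> commutator (phi (p1 x)) (p3 x) \<noteq> (0 :: 'n sqmat)"
proof -
  define x y where "x = skw (coord 1) (coord 4 :: 'n)" and "y = skw (coord 3) (coord 1 :: 'n)"
  \<comment> \<open>The same device in the first summand: \<phi> sends the component
    \<open>- phi y\<close> to \<open>y\<close>, which leaves the bracket [y, x].\<close>
  let ?z = "x - phi y"
  have so: "x \<in> so" "y \<in> so" by (simp_all only: x_def y_def skw_in_so)
  have "block Two One y = y"
    using block_skw[of "coord 3" "coord 1 :: 'n"] by (simp only: cls_simps[OF card4] y_def)
  then have y: "p1 y = y" by (simp only: block_sym[of Two One])
  have x: "p3 x = x" by (simp only: x_def skw_coord[OF card4])
  have y': "p2 y = 0" "p3 y = 0" and x': "p1 x = 0" "p2 x = 0"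
    using p_p(3,5)[of y] p_p(2,4)[of x] by (simp_all only: x y)
  have "p1 ?z = - phi y" "p2 ?z = 0" "p3 ?z = x"
    by (simp_all add: block_linear_simps x y x' y' phi_linear_simps[OF card4] flip: phi_block[OF card4])
  moreover have "phi (phi y) = - y" using phi_phi_p1[OF card4, of y] by (simp only: y)
  moreover have "commutator y x \<noteq> 0"
    using commutator_skw_nth[of "coord 3" "coord 1" "coord 4 :: 'n"] coord4_neq
    by (auto simp: x_def y_def)
  moreover have "?z \<in> so"
    by (intro subspace_diff[OF subspace_so] so phi_in_so[OF card4])
  ultimately show ?thesis
    by (intro bexI[of _ ?z]) (simp_all add: phi_linear_simps[OF card4] mm_iff[OF card4] pm_def)
qed

section \<open>The three conditions on \<open>f0\<close>\<close>

lemma p_zero_phi: "p3 x = 0 \<Longrightarrow> nabla_f x x = ((s - 1) / t) *\<^sub>R commutator (p1 x) (phi (p2 x))"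
  by (simp add: nabla_f_diag commutator_linear_simps)

text \<open>The two witness vectors force (s - 1) / t = 0 and 3 (t - 1) / s = 1. At the resulting
  values the third coefficient of \<open>nabla_f_diag\<close> vanishes too.\<close>

lemma killing_iff: "killing_f_structure g D f0 \<longleftrightarrow> s = 1 \<and> t = 4 / 3"
proof
  assume K: "killing_f_structure g D f0"
  have z: "nabla_f x x = 0" if x: "x \<in> \<mm>" for x
  proof -
    obtain X where X: "vector_field X" "X (mat 1) = x"
      using ex_vector_field[OF card4 x SO_one] by blast
    have "cov_deriv_f D f0 X X (mat 1) = 0"
      using K X(1) SO_one unfolding killing_f_structure_def by blast
    then show ?thesis by (simp only: cov_deriv_f0[OF X(1) X(1) SO_one] X(2))
  qed
  obtain x :: "'n sqmat" where x: "x \<in> \<mm>" "p3 x = 0" "commutator (p1 x) (phi (p2 x)) \<noteq> 0"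
    using ex_commutator_12 by blast
  have s: "s = 1" using z[OF x(1)] x(3) st_pos by (simp add: p_zero_phi[OF x(2)])
  obtain y :: "'n sqmat" where y: "y \<in> \<mm>" "p2 y = 0" "commutator (phi (p1 y)) (p3 y) \<noteq> 0"
    using ex_commutator_13 by blast
  have "((3 * (t - 1) / s - 1) / 2) *\<^sub>R commutator (phi (p1 y)) (p3 y) = 0"
    using z[OF y(1)] by (simp add: nabla_f_diag y(2) phi_linear_simps[OF card4] commutator_linear_simps)
  then have "t = 4 / 3" using y(3) s by simp
  with s show "s = 1 \<and> t = 4 / 3" ..
next
  assume st: "s = 1 \<and> t = 4 / 3"
  then have "s - 1 = 0" "3 * (t - s) - 1 = 0" "3 * (t - 1) / s - 1 = 0" by auto
  then have "nabla_f x x = 0" for x unfolding nabla_f_diag by (simp only:) simp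
  then show "killing_f_structure g D f0"
    unfolding killing_f_structure_def using f0_metric by (simp add: cov_deriv_f0)
qed

lemma p3_f0: "p3 (f0 x) = 0" for x :: "'n sqmat"
  by (simp only: f0_block[OF card4, symmetric] f0_p3[OF card4])

text \<open>On the image of \<open>f0\<close> only the term with (s - 1) / t survives. To test it on
  \<open>x\<close>, a field with value \<open>- f0 x\<close> is chosen, so that
  \<open>f0 \<circ> X\<close> takes the value \<open>x\<close>.\<close>

lemma NK_iff: "NK_f_structure g D f0 \<longleftrightarrow> s = 1"
proof
  assume K: "NK_f_structure g D f0"
  obtain x :: "'n sqmat" where x: "x \<in> \<mm>" "p3 x = 0" "commutator (p1 x) (phi (p2 x)) \<noteq> 0"
    using ex_commutator_12 by blast
  have "- f0 x \<in> \<mm>"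
    using f0_in_mm[OF card4 x(1)] by (rule subspace_neg[OF subspace_mm[OF card4]])
  then obtain X where X: "vector_field X" "X (mat 1) = - f0 x"
    using ex_vector_field[OF card4 _ SO_one] by blast
  have v: "vector_field (f0 \<circ> X)" by (rule vector_field_f0[OF card4 X(1)])
  have "cov_deriv_f D f0 (f0 \<circ> X) (f0 \<circ> X) (mat 1) = 0"
    using K X(1) SO_one unfolding NK_f_structure_def by blast
  then have "nabla_f x x = 0"
    by (simp only: cov_deriv_f0[OF v v SO_one] o_apply X(2) f0_f0[OF x(2,1)])
  then show "s = 1" using x(3) st_pos by (simp add: p_zero_phi[OF x(2)])
next
  assume "s = 1"
  then have "nabla_f (f0 x) (f0 x) = 0" for x unfolding p_zero_phi[OF p3_f0] by simp
  then have "cov_deriv_f D f0 (f0 \<circ> X) (f0 \<circ> X) a = 0" if "vector_field X" "a \<in> SO" for X a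
    using that vector_field_f0[OF card4 that(1)] by (simp only: cov_deriv_f0 o_apply)
  then show "NK_f_structure g D f0"
    unfolding NK_f_structure_def using f0_metric by blast
qed

text \<open>The surviving bracket lies in the third summand, where \<open>f0\<close> is zero; both
  terms of \<open>T_tensor\<close> thus vanish separately, for all s and t.\<close>

lemma G1: "G1_f_structure g D f0"
proof -
  have f: "f0 (nabla_f (f0 x) (f0 x)) = 0" for x
  proof -
    let ?y = "f0 x"
    have "commutator (p1 ?y) (p2 (phi ?y)) = p3 (commutator (p1 ?y) (p2 (phi ?y)))"
      by (simp only: p_of_commutator)
    then have "f0 (commutator (p1 ?y) (phi (p2 ?y))) = 0"
      unfolding phi_block[OF card4] using f0_p3[OF card4] by metis
    then show ?thesis by (simp only: p_zero_phi[OF p3_f0] f0_linear_simps[OF card4] scaleR_zero_right)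
  qed
  have "T_tensor D f0 X X a = 0" if X: "vector_field X" and a: "a \<in> SO" for X a
  proof -
    have v: "vector_field (f0 \<circ> X)" "vector_field (f0 \<circ> f0 \<circ> X)"
      using vector_field_f0[OF card4] X by (simp_all add: comp_assoc)
    show ?thesis
      unfolding T_tensor_def cov_deriv_f0[OF v(1) v(1) a] cov_deriv_f0[OF v(2) v(2) a] o_apply
      by (simp only: f0_linear_simps[OF card4] f diff_self scaleR_zero_right)
  qed
  then show ?thesis unfolding G1_f_structure_def using f0_metric by blast
qed

end

end

theorem theorem2:
  assumes "4 \<le> CARD('n::finite)"
  shows "homogeneous_Phi_space (H :: (real^'n^'n) set) Phi 4 \<and>
    only_canonical_f_structure (f0 :: real^'n^'n \<Rightarrow> real^'n^'n) \<and>
    (\<forall>(g :: real^'n^'n \<Rightarrow> real^'n^'n \<Rightarrow> real) s t D.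
       characteristic_numbers g (s, t) \<longrightarrow> levi_civita g D \<longrightarrow>
         (killing_f_structure g D f0 \<longleftrightarrow> (s, t) = (1, 4 / 3)) \<and>
         (NK_f_structure g D f0 \<longleftrightarrow> (\<exists>t'>0. (s, t) = (1, t'))) \<and>
         G1_f_structure g D f0)"
proof (intro conjI allI impI)
  show "homogeneous_Phi_space (H :: (real^'n^'n) set) Phi 4"
    by (rule Phi_space[OF assms])
  show "only_canonical_f_structure (f0 :: real^'n^'n \<Rightarrow> real^'n^'n)"
    by (rule f0_only[OF assms])
  fix g :: "real^'n^'n \<Rightarrow> real^'n^'n \<Rightarrow> real" and s t D
  assume cn: "characteristic_numbers g (s, t)" and lc: "levi_civita g D"
  show "killing_f_structure g D f0 \<longleftrightarrow> (s, t) = (1, 4 / 3)"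
    using killing_iff[OF assms cn lc] by simp
  show "NK_f_structure g D f0 \<longleftrightarrow> (\<exists>t'>0. (s, t) = (1, t'))"
    using NK_iff[OF assms cn lc] cn by (auto simp: characteristic_numbers_def)
  show "G1_f_structure g D f0"
    by (rule G1[OF assms cn lc])
qed

end
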